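(* Let $\kappa$ be a regular uncountable cardinal, let $I$ be an ideal on $\kappa$, let $\gamma<\kappa$ be a limit ordinal, and let $\mathbb Q$ be a poset with domain $Q$. Then the following hold: (1) Nonempty has a winning strategy in $\mathcal B(I,\gamma)$ if and only if Choose has a winning strategy in $\mathcal G_\infty(X,I,{\le}\gamma)$ for all $X\in I^+$. (2) Nonempty has a winning strategy in $\mathcal B(\mathbb Q,\gamma)$ if and only if Choose has a winning strategy in $\mathcal G_\infty(X,\mathbb Q,\gamma)$ for all $X\in Q$.
   Context: $I^+$ denotes the collection of subsets of $\kappa$ not in $I$ (the $I$-positive sets). For $X\in I^+$, an $I$-partition of $X$ is a maximal collection $W\subseteq P(X)\cap I^+$ such that $A\cap B\in I$ whenever $A,B\in W$ are distinct. Posets are assumed to have a maximal element. Banach-Mazur games. $\mathcal B(I,\gamma)$ has length $\gamma$: players Empty and Nonempty take turns to play $I$-positive sets, forming a $\subseteq$-decreasing sequence, with Empty starting the game and with Nonempty playing first at each limit stage. If at any limit stage $\delta<\gamma$ Nonempty cannot make a valid move, then Empty wins and the game ends. Nonempty wins if the game proceeds for $\gamma$ many rounds and the intersection of the sets that were played is nonempty; otherwise Empty wins. $\mathcal B(\mathbb Q,\gamma)$ is played in the same way, with the players playing elements of $Q$ forming a $\le$-decreasing sequence; Nonempty wins if the game proceeds for $\gamma$ many rounds and the collection of elements that were played has a lower bound in $Q$, and otherwise Empty wins. Cut and choose games. $\mathcal G_\infty(X,I,{\le}\gamma)$ has $\gamma$ many rounds: in each round, Cut plays an $I$-partition of $X$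 (of arbitrary size), and Choose picks one of its elements. Choose wins if for all $\delta<\gamma$ the intersection of their choices up to stage $\delta$ is $I$-positive and the intersection of all their $\gamma$ many choices is nonempty; otherwise Cut wins. $\mathcal G_\infty(X,\mathbb Q,\gamma)$ has $\gamma$ many rounds: in each round, Cut plays a maximal antichain of $\mathbb Q$ below $X$ (of arbitrary size), and Choose picks one of its elements. Choose wins if the sequence of all of their choices has a lower bound in $\mathbb Q$; otherwise Cut wins. *)

theory Defs
  imports "HOL-Library.FuncSet"
begin

unbundle cardinal_syntax

definition regular_uncountable :: "'k rel \<Rightarrow> bool" where
  "regular_uncountable \<kappa> \<longleftrightarrow> Card_order \<kappa> \<and> natLeq <o \<kappa> \<and> regularCard \<kappa>"

text \<open>
  The cardinal \<open>\<kappa>\<close> is a well-order relation. Its elements, those of \<^term>\<open>Field \<kappa>\<close>, are the ordinals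
  below \<open>\<kappa>\<close>; \<^term>\<open>underS \<kappa> \<alpha>\<close> is the set of ordinals \<open>< \<alpha>\<close> and \<^term>\<open>under \<kappa> \<alpha>\<close> the set of
  ordinals \<open>\<le> \<alpha>\<close>. Zero is not counted as a limit.
\<close>

definition limit_ordinal :: "'k rel \<Rightarrow> 'k \<Rightarrow> bool" where
  "limit_ordinal \<kappa> \<alpha> \<longleftrightarrow>
     \<alpha> \<in> Field \<kappa> \<and> underS \<kappa> \<alpha> \<noteq> {} \<and> \<not> (\<exists>\<beta>\<in>Field \<kappa>. \<alpha> = wo_rel.suc \<kappa> {\<beta>})"

text \<open>Ideals are not required to be proper, complete or to contain the singletons.\<close>

definition ideal_on :: "'k set \<Rightarrow> 'k set set \<Rightarrow> bool" where
  "ideal_on S I \<longleftrightarrow>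
     I \<subseteq> Pow S \<and> {} \<in> I \<and> (\<forall>A\<in>I. \<forall>B. B \<subseteq> A \<longrightarrow> B \<in> I) \<and> (\<forall>A\<in>I. \<forall>B\<in>I. A \<union> B \<in> I)"

definition positive_sets :: "'k set \<Rightarrow> 'k set set \<Rightarrow> 'k set set" where
  "positive_sets S I = Pow S - I"

definition almost_disjoint_family :: "'k set \<Rightarrow> 'k set set \<Rightarrow> 'k set \<Rightarrow> 'k set set \<Rightarrow> bool" where
  "almost_disjoint_family S I X W \<longleftrightarrow>
     W \<subseteq> Pow X \<inter> positive_sets S I \<and> (\<forall>A\<in>W. \<forall>B\<in>W. A \<noteq> B \<longrightarrow> A \<inter> B \<in> I)"

definition ideal_partition :: "'k set \<Rightarrow> 'k set set \<Rightarrow> 'k set \<Rightarrow> 'k set set \<Rightarrow> bool" where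
  "ideal_partition S I X W \<longleftrightarrow>
     almost_disjoint_family S I X W \<and>
     (\<forall>W'. almost_disjoint_family S I X W' \<and> W \<subseteq> W' \<longrightarrow> W' = W)"

text \<open>\<^term>\<open>(p, q) \<in> r\<close> means \<open>p \<le> q\<close>. ``Maximal element'' is taken literally; a poset with a greatest
  element is in particular covered.\<close>

definition poset_with_maximal :: "'q set \<Rightarrow> 'q rel \<Rightarrow> bool" where
  "poset_with_maximal Q r \<longleftrightarrow>
     partial_order_on Q r \<and> (\<exists>m\<in>Q. \<forall>q\<in>Q. (m, q) \<in> r \<longrightarrow> q = m)"

definition compatible :: "'q set \<Rightarrow> 'q rel \<Rightarrow> 'q \<Rightarrow> 'q \<Rightarrow> bool" where
  "compatible Q r p q \<longleftrightarrow> (\<exists>s\<in>Q. (s, p) \<in> r \<and> (s, q) \<in> r)"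

definition antichain_below :: "'q set \<Rightarrow> 'q rel \<Rightarrow> 'q \<Rightarrow> 'q set \<Rightarrow> bool" where
  "antichain_below Q r X A \<longleftrightarrow>
     A \<subseteq> {q \<in> Q. (q, X) \<in> r} \<and> (\<forall>p\<in>A. \<forall>q\<in>A. p \<noteq> q \<longrightarrow> \<not> compatible Q r p q)"

definition maximal_antichain_below :: "'q set \<Rightarrow> 'q rel \<Rightarrow> 'q \<Rightarrow> 'q set \<Rightarrow> bool" where
  "maximal_antichain_below Q r X A \<longleftrightarrow>
     antichain_below Q r X A \<and> (\<forall>A'. antichain_below Q r X A' \<and> A \<subseteq> A' \<longrightarrow> A' = A)"

text \<open>
  A play is a sequence of single moves indexed by ordinals: Empty makes move 0, the players
  alternate at successors, and Nonempty makes the move at each limit. For a game whose length is a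
  limit ordinal it does not matter whether length counts single moves or pairs of moves.
\<close>

inductive empty_moves_at and nonempty_moves_at for \<kappa> :: "'k rel" where
  zero: "\<alpha> \<in> Field \<kappa> \<Longrightarrow> underS \<kappa> \<alpha> = {} \<Longrightarrow> empty_moves_at \<kappa> \<alpha>"
| limit: "limit_ordinal \<kappa> \<alpha> \<Longrightarrow> nonempty_moves_at \<kappa> \<alpha>"
| suc_empty: "empty_moves_at \<kappa> \<alpha> \<Longrightarrow> nonempty_moves_at \<kappa> (wo_rel.suc \<kappa> {\<alpha>})"
| suc_nonempty: "nonempty_moves_at \<kappa> \<alpha> \<Longrightarrow> empty_moves_at \<kappa> (wo_rel.suc \<kappa> {\<alpha>})"

text \<open>\<open>M\<close> is the set of moves and \<open>le\<close> their ordering.\<close>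

definition bm_legal_move ::
  "'k rel \<Rightarrow> 'm set \<Rightarrow> ('m \<Rightarrow> 'm \<Rightarrow> bool) \<Rightarrow> 'k \<Rightarrow> ('k \<Rightarrow> 'm) \<Rightarrow> 'm \<Rightarrow> bool" where
  "bm_legal_move \<kappa> M le \<alpha> p x \<longleftrightarrow> x \<in> M \<and> (\<forall>\<beta>\<in>underS \<kappa> \<alpha>. le x (p \<beta>))"

definition bm_play ::
  "'k rel \<Rightarrow> 'm set \<Rightarrow> ('m \<Rightarrow> 'm \<Rightarrow> bool) \<Rightarrow> 'k \<Rightarrow> ('k \<Rightarrow> 'm) \<Rightarrow> bool" where
  "bm_play \<kappa> M le \<delta> p \<longleftrightarrow> (\<forall>\<alpha>\<in>underS \<kappa> \<delta>. bm_legal_move \<kappa> M le \<alpha> p (p \<alpha>))"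

text \<open>A strategy for Nonempty maps a stage \<open>\<alpha>\<close> and the sequence of all moves made before \<open>\<alpha>\<close> to a move.\<close>

definition bm_follows :: "'k rel \<Rightarrow> ('k \<Rightarrow> ('k \<Rightarrow> 'm) \<Rightarrow> 'm) \<Rightarrow> 'k \<Rightarrow> ('k \<Rightarrow> 'm) \<Rightarrow> bool" where
  "bm_follows \<kappa> \<tau> \<delta> p \<longleftrightarrow>
     (\<forall>\<alpha>\<in>underS \<kappa> \<delta>. nonempty_moves_at \<kappa> \<alpha> \<longrightarrow> p \<alpha> = \<tau> \<alpha> (restrict p (underS \<kappa> \<alpha>)))"

text \<open>
  The first conjunct says that a play following \<open>\<tau>\<close> never gets stuck: \<open>\<tau>\<close> answers with a legal move, in
  particular at limit stages, where Nonempty would otherwise lose.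
\<close>

definition bm_nonempty_winning ::
  "'k rel \<Rightarrow> 'm set \<Rightarrow> ('m \<Rightarrow> 'm \<Rightarrow> bool) \<Rightarrow> 'k \<Rightarrow> (('k \<Rightarrow> 'm) \<Rightarrow> bool)
     \<Rightarrow> ('k \<Rightarrow> ('k \<Rightarrow> 'm) \<Rightarrow> 'm) \<Rightarrow> bool" where
  "bm_nonempty_winning \<kappa> M le \<gamma> won \<tau> \<longleftrightarrow>
     (\<forall>\<delta>\<in>underS \<kappa> \<gamma>. \<forall>p. nonempty_moves_at \<kappa> \<delta> \<and> bm_play \<kappa> M le \<delta> p \<and> bm_follows \<kappa> \<tau> \<delta> p
        \<longrightarrow> bm_legal_move \<kappa> M le \<delta> p (\<tau> \<delta> (restrict p (underS \<kappa> \<delta>)))) \<and>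
     (\<forall>p. bm_play \<kappa> M le \<gamma> p \<and> bm_follows \<kappa> \<tau> \<gamma> p \<longrightarrow> won p)"

definition nonempty_wins_B_ideal :: "'k rel \<Rightarrow> 'k set set \<Rightarrow> 'k \<Rightarrow> bool" where
  "nonempty_wins_B_ideal \<kappa> I \<gamma> \<longleftrightarrow>
     (\<exists>\<tau>. bm_nonempty_winning \<kappa> (positive_sets (Field \<kappa>) I) (\<subseteq>) \<gamma>
            (\<lambda>p. (\<Inter>\<alpha>\<in>underS \<kappa> \<gamma>. p \<alpha>) \<noteq> {}) \<tau>)"

definition nonempty_wins_B_poset :: "'k rel \<Rightarrow> 'q set \<Rightarrow> 'q rel \<Rightarrow> 'k \<Rightarrow> bool" where
  "nonempty_wins_B_poset \<kappa> Q r \<gamma> \<longleftrightarrow>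
     (\<exists>\<tau>. bm_nonempty_winning \<kappa> Q (\<lambda>x y. (x, y) \<in> r) \<gamma>
            (\<lambda>p. \<exists>q\<in>Q. \<forall>\<alpha>\<in>underS \<kappa> \<gamma>. (q, p \<alpha>) \<in> r) \<tau>)"

text \<open>
  In round \<open>\<alpha>\<close> Cut plays \<open>W \<alpha>\<close> and Choose answers with \<open>c \<alpha>\<close>. A strategy for Choose maps the round,
  Cut's moves up to and including this round, and Choose's own earlier moves to a choice.
\<close>

definition cc_choose_winning ::
  "'k rel \<Rightarrow> ('m set \<Rightarrow> bool) \<Rightarrow> 'k \<Rightarrow> (('k \<Rightarrow> 'm) \<Rightarrow> bool)
     \<Rightarrow> ('k \<Rightarrow> ('k \<Rightarrow> 'm set) \<Rightarrow> ('k \<Rightarrow> 'm) \<Rightarrow> 'm) \<Rightarrow> bool" where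
  "cc_choose_winning \<kappa> legal \<gamma> won \<sigma> \<longleftrightarrow>
     (\<forall>W c. (\<forall>\<alpha>\<in>underS \<kappa> \<gamma>. legal (W \<alpha>)) \<and>
            (\<forall>\<alpha>\<in>underS \<kappa> \<gamma>. c \<alpha> = \<sigma> \<alpha> (restrict W (under \<kappa> \<alpha>)) (restrict c (underS \<kappa> \<alpha>)))
        \<longrightarrow> (\<forall>\<alpha>\<in>underS \<kappa> \<gamma>. c \<alpha> \<in> W \<alpha>) \<and> won c)"

text \<open>
  ``Up to stage \<open>\<delta>\<close>'' is read inclusively. As \<open>\<gamma>\<close> is a limit and positivity passes to
  supersets, this agrees with the exclusive reading, but avoids an empty intersection for \<open>\<delta> = 0\<close>.
\<close>

definition choose_wins_G_ideal :: "'k rel \<Rightarrow> 'k set \<Rightarrow> 'k set set \<Rightarrow> 'k \<Rightarrow> bool" where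
  "choose_wins_G_ideal \<kappa> X I \<gamma> \<longleftrightarrow>
     (\<exists>\<sigma>. cc_choose_winning \<kappa> (ideal_partition (Field \<kappa>) I X) \<gamma>
            (\<lambda>c. (\<forall>\<delta>\<in>underS \<kappa> \<gamma>. (\<Inter>\<alpha>\<in>under \<kappa> \<delta>. c \<alpha>) \<in> positive_sets (Field \<kappa>) I) \<and>
                 (\<Inter>\<alpha>\<in>underS \<kappa> \<gamma>. c \<alpha>) \<noteq> {}) \<sigma>)"

definition choose_wins_G_poset :: "'k rel \<Rightarrow> 'q \<Rightarrow> 'q set \<Rightarrow> 'q rel \<Rightarrow> 'k \<Rightarrow> bool" where
  "choose_wins_G_poset \<kappa> X Q r \<gamma> \<longleftrightarrow>
     (\<exists>\<sigma>. cc_choose_winning \<kappa> (maximal_antichain_below Q r X) \<gamma>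
            (\<lambda>c. \<exists>q\<in>Q. \<forall>\<alpha>\<in>underS \<kappa> \<gamma>. (q, c \<alpha>) \<in> r) \<sigma>)"

end

theory Submission
  imports Defs
begin

text \<open>
  Both equivalences are instances of one statement about a poset \<open>Q\<close> and a winning condition \<open>L\<close> on
  the set of moves that survives passing to larger elements
  (\<open>game_setting.nonempty_wins_iff_choose_wins\<close>). For the ideal games the poset consists of the
  positive sets under inclusion: two positive sets are compatible iff their intersection is
  positive, so \<open>I\<close>-partitions of \<open>X\<close> are exactly maximal antichains below \<open>X\<close>
  (\<open>ideal_partition_iff_maximal_antichain\<close>). There \<open>L\<close> says that the intersection of the moves is
  nonempty, in the poset games that the moves have a lower bound.

  From Nonempty to Choose: Choose privately runs a Banach-Mazur play that Empty opens below \<open>X\<close>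
  and in which Nonempty uses the winning strategy. When Cut plays a maximal antichain, it has an
  element compatible with Nonempty's last move; Choose picks such an element, and Empty plays a
  common lower bound of the two. The private play stays below Choose's picks, so whatever
  witnesses Nonempty's win also witnesses a win for Choose. Each round of the cut-and-choose game
  uses up a move of each player of the private play, so rounds have to be embedded into stages
  (\<open>ex_round_stage\<close>).

  From Choose to Nonempty: let Empty open with \<open>X\<close>, and let Choose's strategy \<open>\<sigma>\<close> be winning for
  \<open>X\<close>. Nonempty privately runs a cut-and-choose game against \<open>\<sigma>\<close> in which the picks are Empty's
  moves. This works because below any position of that game there is an element \<open>y\<close> such that every
  \<open>z \<le> y\<close> is the answer of \<open>\<sigma>\<close> to some maximal antichain (\<open>ex_all_below_answers\<close>). Otherwise the
  elements that are never an answer would be dense below the position; a maximal antichain that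
  consists of such elements, together with elements having no extension to a lower bound of the
  position, could then not be answered without losing. Nonempty plays such a \<open>y\<close>; Empty's reply \<open>z\<close>
  is then turned into a pick. At the stages where Nonempty moves, Cut plays the trivial antichain
  \<open>{X}\<close>, so that here rounds and stages can be the same ordinals.
\<close>

section \<open>Ordinal stages and whose turn it is\<close>

locale unbounded_well_order =
  fixes \<kappa> :: "'k rel"
  assumes well_order: "Well_order \<kappa>"
    and unbounded: "\<alpha> \<in> Field \<kappa> \<Longrightarrow> \<exists>\<beta>. \<alpha> \<in> underS \<kappa> \<beta>"
begin

sublocale wo_rel \<kappa>
  using well_order by (simp add: wo_rel_def)

abbreviation succ :: "'k \<Rightarrow> 'k" where
  "succ \<alpha> \<equiv> suc {\<alpha>}"

lemma less_trans: "\<alpha> \<in> underS \<beta> \<Longrightarrow> \<beta> \<in> underS \<delta> \<Longrightarrow> \<alpha> \<in> underS \<delta>"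
  using TRANS ANTISYM unfolding Order_Relation.underS_def
  by (metis (mono_tags, lifting) antisymD mem_Collect_eq transD)

lemma less_asym: "\<alpha> \<in> underS \<beta> \<Longrightarrow> \<beta> \<in> underS \<alpha> \<Longrightarrow> False"
  using less_trans[of \<alpha> \<beta> \<alpha>] by (simp add: Order_Relation.underS_def)

lemma less_Field: "\<alpha> \<in> underS \<beta> \<Longrightarrow> \<alpha> \<in> Field \<kappa> \<and> \<beta> \<in> Field \<kappa>"
  by (auto simp: underS_def Field_def)

lemma less_linear:
  "\<alpha> \<in> Field \<kappa> \<Longrightarrow> \<beta> \<in> Field \<kappa> \<Longrightarrow> \<alpha> \<in> underS \<beta> \<or> \<alpha> = \<beta> \<or> \<beta> \<in> underS \<alpha>"
  using TOTALS by (auto simp: underS_def)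

lemma under_eq: "\<alpha> \<in> Field \<kappa> \<Longrightarrow> under \<alpha> = insert \<alpha> (underS \<alpha>)"
  using REFL by (auto simp: under_def underS_def refl_on_def)

lemma under_trans: "\<alpha> \<in> under \<beta> \<Longrightarrow> \<beta> \<in> under \<delta> \<Longrightarrow> \<alpha> \<in> under \<delta>"
  using TRANS by (auto simp: under_def trans_def)

lemma underS_under: "\<alpha> \<in> underS \<beta> \<Longrightarrow> \<alpha> \<in> under \<beta>"
  by (auto simp: under_def underS_def)

lemma underS_subset_under: "\<alpha> \<in> under \<beta> \<Longrightarrow> underS \<alpha> \<subseteq> under \<beta>"
  by (meson subsetI under_trans underS_under)

lemma under_subset_underS:
  assumes "\<alpha> \<in> underS \<beta>"
  shows "under \<alpha> \<subseteq> underS \<beta>"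
proof -
  have "under \<alpha> = insert \<alpha> (underS \<alpha>)"
    using assms less_Field under_eq by metis
  then show ?thesis
    using assms by (auto intro: less_trans)
qed

lemma less_induct [consumes 1, case_names less]:
  assumes "\<alpha> \<in> Field \<kappa>"
    and "\<And>\<alpha>. \<alpha> \<in> Field \<kappa> \<Longrightarrow> (\<And>\<beta>. \<beta> \<in> underS \<alpha> \<Longrightarrow> P \<beta>) \<Longrightarrow> P \<alpha>"
  shows "P \<alpha>"
  using assms(1)
proof (induction \<alpha> rule: well_order_induct)
  case (1 \<alpha>)
  show ?case
    by (rule assms(2)[OF 1(2)]) (use 1 in \<open>auto simp: underS_def Field_def\<close>)
qed

lemma AboveS_nonempty: "\<alpha> \<in> Field \<kappa> \<Longrightarrow> AboveS {\<alpha>} \<noteq> {}"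
  using unbounded[of \<alpha>] by (auto simp: AboveS_def underS_def Field_def)

lemma less_succ: "\<alpha> \<in> Field \<kappa> \<Longrightarrow> \<alpha> \<in> underS (succ \<alpha>)"
  using suc_greater[of "{\<alpha>}" \<alpha>] AboveS_nonempty[of \<alpha>] by (auto simp: Order_Relation.underS_def)

lemma succ_Field: "\<alpha> \<in> Field \<kappa> \<Longrightarrow> succ \<alpha> \<in> Field \<kappa>"
  using less_succ less_Field by blast

lemma succ_le: "\<alpha> \<in> underS \<beta> \<Longrightarrow> succ \<alpha> \<in> under \<beta>"
  using suc_least_AboveS[of \<beta> "{\<alpha>}"] by (auto simp: AboveS_def underS_def under_def Field_def)

lemma underS_succ: "\<alpha> \<in> Field \<kappa> \<Longrightarrow> underS (succ \<alpha>) = under \<alpha>"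
proof (intro equalityI subsetI)
  fix \<beta> assume a: "\<alpha> \<in> Field \<kappa>" and b: "\<beta> \<in> underS (succ \<alpha>)"
  have "\<alpha> \<notin> underS \<beta>"
    using succ_le[of \<alpha> \<beta>] b less_asym[of \<beta> "succ \<alpha>"] under_eq[of \<beta>] less_Field[of \<beta> "succ \<alpha>"]
    by auto
  then show "\<beta> \<in> under \<alpha>"
    using less_linear[of \<alpha> \<beta>] a less_Field[OF b] under_eq[OF a] by auto
next
  fix \<beta> assume "\<alpha> \<in> Field \<kappa>" and "\<beta> \<in> under \<alpha>"
  then show "\<beta> \<in> underS (succ \<alpha>)"
    using under_subset_underS[OF less_succ] by auto
qed

lemma succ_inj:
  assumes "\<alpha> \<in> Field \<kappa>" "\<beta> \<in> Field \<kappa>" "succ \<alpha> = succ \<beta>"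
  shows "\<alpha> = \<beta>"
proof -
  have "under \<alpha> = under \<beta>"
    using assms underS_succ by metis
  then have "\<alpha> \<in> under \<beta>" "\<beta> \<in> under \<alpha>"
    using assms under_eq by auto
  then show ?thesis
    using ANTISYM by (auto simp: Order_Relation.under_def dest: antisymD)
qed

lemma limit_Field: "limit_ordinal \<kappa> \<mu> \<Longrightarrow> \<mu> \<in> Field \<kappa>"
  by (simp add: limit_ordinal_def)

lemma succ_less_limit:
  assumes "limit_ordinal \<kappa> \<mu>" "\<alpha> \<in> underS \<mu>"
  shows "succ \<alpha> \<in> underS \<mu>"
  using assms succ_le[of \<alpha> \<mu>] under_eq[of \<mu>] less_Field[of \<alpha> \<mu>] by (auto simp: limit_ordinal_def)

lemma stage_cases [consumes 1, case_names zero succ limit]: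
  assumes "\<alpha> \<in> Field \<kappa>"
  obtains "underS \<alpha> = {}" | \<beta> where "\<beta> \<in> Field \<kappa>" "\<alpha> = succ \<beta>" | "limit_ordinal \<kappa> \<alpha>"
  using assms by (auto simp: limit_ordinal_def)

definition first :: 'k where "first = minim (Field \<kappa>)"

lemma first_le: "\<alpha> \<in> Field \<kappa> \<Longrightarrow> first \<in> under \<alpha>"
  using minim_least[of "Field \<kappa>" \<alpha>] by (simp add: first_def under_def)

lemma underS_first: "underS first = {}"
proof (rule ccontr)
  assume "underS first \<noteq> {}"
  then obtain \<alpha> where \<alpha>: "\<alpha> \<in> underS first"
    by blast
  then have "first \<in> under \<alpha>"
    using first_le less_Field by metis
  then show False
    using \<alpha> under_subset_underS[OF \<alpha>] by (auto simp: Order_Relation.underS_def)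
qed

lemma first_unique: "\<alpha> \<in> Field \<kappa> \<Longrightarrow> underS \<alpha> = {} \<longleftrightarrow> \<alpha> = first"
  using first_le[of \<alpha>] under_eq[of \<alpha>] underS_first by auto

lemma first_less: "\<beta> \<in> underS \<alpha> \<Longrightarrow> first \<in> underS \<alpha>"
  using first_le[of \<beta>] less_Field[of \<beta> \<alpha>] under_subset_underS[of \<beta> \<alpha>] by auto

lemma moves_Field:
  "empty_moves_at \<kappa> \<alpha> \<Longrightarrow> \<alpha> \<in> Field \<kappa>"
  "nonempty_moves_at \<kappa> \<alpha> \<Longrightarrow> \<alpha> \<in> Field \<kappa>"
  by (induction rule: empty_moves_at_nonempty_moves_at.inducts)
     (auto simp: succ_Field limit_ordinal_def)

lemma empty_move_cases:
  "empty_moves_at \<kappa> \<alpha> \<Longrightarrow> underS \<alpha> = {} \<or> (\<exists>\<nu>. nonempty_moves_at \<kappa> \<nu> \<and> \<alpha> = succ \<nu>)"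
  by (erule empty_moves_at.cases) auto

lemma nonempty_move_cases:
  "nonempty_moves_at \<kappa> \<alpha> \<Longrightarrow> limit_ordinal \<kappa> \<alpha> \<or> (\<exists>\<nu>. empty_moves_at \<kappa> \<nu> \<and> \<alpha> = succ \<nu>)"
  by (erule nonempty_moves_at.cases) auto

lemma underS_succ_nonempty: "\<alpha> \<in> Field \<kappa> \<Longrightarrow> underS (succ \<alpha>) \<noteq> {}"
  using less_succ by blast

lemma limit_not_succ: "limit_ordinal \<kappa> \<mu> \<Longrightarrow> \<beta> \<in> Field \<kappa> \<Longrightarrow> \<mu> \<noteq> succ \<beta>"
  by (auto simp: limit_ordinal_def)

lemma limit_underS: "limit_ordinal \<kappa> \<mu> \<Longrightarrow> underS \<mu> \<noteq> {}"
  by (simp add: limit_ordinal_def)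

text \<open>
  A successor determines its predecessor, and zero, successors and limits are distinct kinds of
  stages, so the alternation of the two players is well defined.
\<close>

lemma moves_exclusive:
  "empty_moves_at \<kappa> \<alpha> \<Longrightarrow> \<not> nonempty_moves_at \<kappa> \<alpha>"
  "nonempty_moves_at \<kappa> \<alpha> \<Longrightarrow> \<not> empty_moves_at \<kappa> \<alpha>"
proof (induction rule: empty_moves_at_nonempty_moves_at.inducts)
  case (zero \<alpha>)
  then show ?case
    by (metis limit_underS nonempty_move_cases moves_Field(1) underS_succ_nonempty)
next
  case (limit \<alpha>)
  then show ?case
    by (metis empty_move_cases limit_not_succ limit_underS moves_Field(2))
next
  case (suc_empty \<alpha>)
  then show ?case
    by (metis empty_move_cases moves_Field succ_inj underS_succ_nonempty)
next
  case (suc_nonempty \<alpha>)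
  then show ?case
    by (metis nonempty_move_cases limit_not_succ moves_Field succ_inj)
qed

lemma moves_total: "\<alpha> \<in> Field \<kappa> \<Longrightarrow> empty_moves_at \<kappa> \<alpha> \<or> nonempty_moves_at \<kappa> \<alpha>"
proof (induction \<alpha> rule: less_induct)
  case (less \<alpha>)
  from less.hyps show ?case
  proof (cases rule: stage_cases)
    case zero
    then show ?thesis
      using less.hyps empty_moves_at_nonempty_moves_at.zero by metis
  next
    case (succ \<beta>)
    then show ?thesis
      using less.IH[of \<beta>] less_succ[of \<beta>] empty_moves_at_nonempty_moves_at.suc_empty
        empty_moves_at_nonempty_moves_at.suc_nonempty by metis
  next
    case limit
    then show ?thesis
      using empty_moves_at_nonempty_moves_at.limit by metis
  qed
qed

lemma empty_moves_iff:
  assumes "\<alpha> \<in> Field \<kappa>"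
  shows "empty_moves_at \<kappa> \<alpha> \<longleftrightarrow> \<alpha> = first \<or> (\<exists>\<nu>. nonempty_moves_at \<kappa> \<nu> \<and> \<alpha> = succ \<nu>)"
  using assms first_unique[OF assms] empty_move_cases[of \<alpha>]
    empty_moves_at_nonempty_moves_at.zero empty_moves_at_nonempty_moves_at.suc_nonempty by metis

lemma nonempty_move_not_first: "nonempty_moves_at \<kappa> \<alpha> \<Longrightarrow> first \<in> underS \<alpha>"
  using moves_Field(2)[of \<alpha>] first_le[of \<alpha>] under_eq[of \<alpha>] moves_exclusive(2)[of \<alpha>]
    empty_moves_iff[of \<alpha>] by auto

text \<open>
  Course-of-values recursion that hands the step function the history in the same restricted form
  in which strategies receive it.
\<close>

definition wo_rec :: "('k \<Rightarrow> ('k \<Rightarrow> 'b) \<Rightarrow> 'b) \<Rightarrow> 'k \<Rightarrow> 'b" where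
  "wo_rec G = wfrec (\<kappa> - Id) (\<lambda>f \<alpha>. G \<alpha> f)"

lemma cut_eq_restrict: "cut f (\<kappa> - Id) \<alpha> = restrict f (underS \<alpha>)"
  by (auto simp: cut_def restrict_def Order_Relation.underS_def)

lemma wo_rec: "wo_rec G \<alpha> = G \<alpha> (restrict (wo_rec G) (underS \<alpha>))"
  unfolding wo_rec_def by (subst wfrec[OF WF]) (simp add: cut_eq_restrict)

text \<open>
  This gives the locality on which both translations rest: a simulated position depends only on
  what has been played so far.
\<close>

lemma wo_rec_cong:
  assumes "\<alpha> \<in> Field \<kappa>" "\<And>\<beta> h. \<beta> \<in> under \<alpha> \<Longrightarrow> G \<beta> h = G' \<beta> h"
  shows "wo_rec G \<alpha> = wo_rec G' \<alpha>"
  using assms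
proof (induction \<alpha> rule: less_induct)
  case (less \<alpha>)
  have "wo_rec G \<beta> = wo_rec G' \<beta>" if "\<beta> \<in> underS \<alpha>" for \<beta>
    using less.IH[OF that] less.prems underS_subset_under underS_under[OF that]
    by (meson under_trans)
  then have "restrict (wo_rec G) (underS \<alpha>) = restrict (wo_rec G') (underS \<alpha>)"
    by (auto simp: restrict_def)
  moreover have "\<alpha> \<in> under \<alpha>"
    using less.hyps under_eq by auto
  ultimately show ?case
    using less.prems wo_rec[of G \<alpha>] wo_rec[of G' \<alpha>] by metis
qed

text \<open>
  The stage at which Empty makes the move that belongs to a round. In ordinal arithmetic, with \<open>\<mu>\<close>
  zero or a limit, it sends the round \<open>\<mu> + n\<close> to \<open>\<mu> + 2n + 1\<close> if \<open>\<mu>\<close> is a limit and to \<open>2n + 2\<close> if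
  \<open>\<mu>\<close> is zero, where Empty's opening move comes first. It does not cross limits, so games of limit
  length are mapped into themselves.
\<close>

lemma ex_round_stage:
  obtains e :: "'k \<Rightarrow> 'k"
  where "\<And>\<alpha>. \<alpha> \<in> Field \<kappa> \<Longrightarrow> \<exists>\<nu>. nonempty_moves_at \<kappa> \<nu> \<and> e \<alpha> = succ \<nu>"
    and "\<And>\<alpha> \<beta>. \<beta> \<in> underS \<alpha> \<Longrightarrow> e \<beta> \<in> underS (e \<alpha>)"
    and "\<And>\<alpha> \<mu>. limit_ordinal \<kappa> \<mu> \<Longrightarrow> \<alpha> \<in> underS \<mu> \<Longrightarrow> e \<alpha> \<in> underS \<mu>"
proof -
  define G where "G \<alpha> h = (if \<alpha> = first then succ (succ first)
      else if limit_ordinal \<kappa> \<alpha> then succ \<alpha>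
      else succ (succ (h (SOME \<beta>. \<beta> \<in> Field \<kappa> \<and> \<alpha> = succ \<beta>))))" for \<alpha> :: 'k and h :: "'k \<Rightarrow> 'k"
  define e where "e = wo_rec G"
  have e_first: "e first = succ (succ first)"
    unfolding e_def by (subst wo_rec) (simp add: G_def)
  have e_limit: "e \<alpha> = succ \<alpha>" if "limit_ordinal \<kappa> \<alpha>" for \<alpha>
    unfolding e_def using that underS_first by (subst wo_rec) (auto simp: G_def limit_ordinal_def)
  have e_succ: "e (succ \<beta>) = succ (succ (e \<beta>))" if "\<beta> \<in> Field \<kappa>" for \<beta>
  proof -
    have "(SOME \<beta>'. \<beta>' \<in> Field \<kappa> \<and> succ \<beta> = succ \<beta>') = \<beta>"
      using that succ_inj by (intro some_equality) auto
    then show ?thesis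
      unfolding e_def using that less_succ[OF that] underS_first
      by (subst wo_rec) (auto simp: G_def limit_ordinal_def)
  qed
  have moves: "\<exists>\<nu>. nonempty_moves_at \<kappa> \<nu> \<and> e \<alpha> = succ \<nu>" if "\<alpha> \<in> Field \<kappa>" for \<alpha>
    using that
  proof (induction \<alpha> rule: less_induct)
    case (less \<alpha>)
    from less.hyps show ?case
    proof (cases rule: stage_cases)
      case zero
      then have "\<alpha> = first" "empty_moves_at \<kappa> first"
        using less.hyps first_unique[OF less.hyps] empty_moves_iff[OF less.hyps] by auto
      then show ?thesis
        using e_first empty_moves_at_nonempty_moves_at.suc_empty by metis
    next
      case (succ \<beta>)
      then obtain \<nu> where "nonempty_moves_at \<kappa> \<nu>" "e \<beta> = succ \<nu>"
        using less.IH[of \<beta>] less_succ[of \<beta>] by auto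
      then have "nonempty_moves_at \<kappa> (succ (e \<beta>))"
        using empty_moves_at_nonempty_moves_at.suc_empty
          empty_moves_at_nonempty_moves_at.suc_nonempty by metis
      then show ?thesis
        using e_succ[of \<beta>] succ by metis
    next
      case limit
      then show ?thesis
        using e_limit empty_moves_at_nonempty_moves_at.limit by metis
    qed
  qed
  have e_Field: "e \<alpha> \<in> Field \<kappa>" if "\<alpha> \<in> Field \<kappa>" for \<alpha>
    using moves[OF that] succ_Field moves_Field(2) by metis
  have below_limit: "e \<alpha> \<in> underS \<mu>" if "limit_ordinal \<kappa> \<mu>" "\<alpha> \<in> underS \<mu>" for \<alpha> \<mu>
  proof -
    have "\<alpha> \<in> Field \<kappa>" using that(2) less_Field by metis
    then show ?thesis using that(2)
    proof (induction \<alpha> rule: less_induct)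
      case (less \<alpha>)
      from less.hyps show ?case
      proof (cases rule: stage_cases)
        case zero
        then have "\<alpha> = first"
          using first_unique[OF less.hyps] by simp
        then show ?thesis
          using e_first less.prems succ_less_limit[OF that(1)] by simp
      next
        case (succ \<beta>)
        then have "\<beta> \<in> underS \<alpha>" "\<beta> \<in> underS \<mu>"
          using less_succ less_trans[of \<beta> \<alpha> \<mu>] less.prems by auto
        then have "e \<beta> \<in> underS \<mu>"
          by (rule less.IH)
        then show ?thesis
          using e_succ[of \<beta>] succ succ_less_limit[OF that(1)] by simp
      next
        case limit
        then show ?thesis
          using e_limit[of \<alpha>] less.prems succ_less_limit[OF that(1)] by simp
      qed
    qed
  qed
  have mono: "e \<beta> \<in> underS (e \<alpha>)" if "\<beta> \<in> underS \<alpha>" for \<alpha> \<beta>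
  proof -
    have "\<alpha> \<in> Field \<kappa>" using that less_Field by metis
    then show ?thesis using that
    proof (induction \<alpha> rule: less_induct)
      case (less \<alpha>)
      from less.hyps show ?case
      proof (cases rule: stage_cases)
        case zero
        then show ?thesis using less.prems by simp
      next
        case (succ \<delta>)
        have *: "e \<delta> \<in> underS (e \<alpha>)"
          using less_trans[OF less_succ less_succ] succ e_succ[of \<delta>] e_Field[of \<delta>] succ_Field
          by simp
        consider "\<beta> = \<delta>" | "\<beta> \<in> underS \<delta>"
          using less.prems succ underS_succ[of \<delta>] under_eq[of \<delta>] by auto
        then show ?thesis
        proof cases
          case 2
          then have "e \<beta> \<in> underS (e \<delta>)"
            using less.IH[of \<delta>] succ less_succ[of \<delta>] by simp
          then show ?thesis
            using * by (rule less_trans)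
        qed (use * in simp)
      next
        case limit
        then show ?thesis
          using less_trans[OF below_limit less_succ] e_limit[of \<alpha>] less by simp
      qed
    qed
  qed
  from moves mono below_limit show ?thesis
    by (rule that)
qed

end

section \<open>Maximal antichains\<close>

lemma maximal_antichain_meets:
  assumes refl: "\<And>q. q \<in> Q \<Longrightarrow> (q, q) \<in> r"
    and V: "maximal_antichain_below Q r X V" and y: "y \<in> Q" "(y, X) \<in> r"
  shows "\<exists>A\<in>V. compatible Q r y A"
proof (rule ccontr)
  assume *: "\<not> ?thesis"
  then have "antichain_below Q r X (insert y V)"
    using V y unfolding maximal_antichain_below_def antichain_below_def compatible_def by blast
  then have "y \<in> V"
    using V unfolding maximal_antichain_below_def by blast
  then show False
    using * y refl by (auto simp: compatible_def)
qed

text \<open>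
  An antichain that is maximal among those contained in a dense set is maximal outright: an element
  incompatible with all its members could be shrunk into the dense set and added.
\<close>

lemma maximal_antichain_in_dense:
  assumes refl: "\<And>q. q \<in> Q \<Longrightarrow> (q, q) \<in> r" and trans: "trans r"
    and D: "D \<subseteq> {q \<in> Q. (q, X) \<in> r}"
    and dense: "\<And>q. q \<in> Q \<Longrightarrow> (q, X) \<in> r \<Longrightarrow> \<exists>d\<in>D. (d, q) \<in> r"
  obtains V where "V \<subseteq> D" "maximal_antichain_below Q r X V"
proof -
  let ?\<A> = "{V. V \<subseteq> D \<and> antichain_below Q r X V}"
  have "\<exists>V\<in>?\<A>. \<forall>W\<in>?\<A>. V \<subseteq> W \<longrightarrow> W = V"
  proof (rule subset_Zorn')
    fix C assume "subset.chain ?\<A> C"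
    then have C: "\<And>A. A \<in> C \<Longrightarrow> A \<subseteq> D" "\<And>A. A \<in> C \<Longrightarrow> antichain_below Q r X A"
      and chain: "\<And>A B. A \<in> C \<Longrightarrow> B \<in> C \<Longrightarrow> A \<subseteq> B \<or> B \<subseteq> A"
      by (auto simp: subset_chain_def)
    have "\<not> compatible Q r p q" if pq: "p \<in> \<Union>C" "q \<in> \<Union>C" "p \<noteq> q" for p q
    proof -
      obtain A B where AB: "A \<in> C" "B \<in> C" "p \<in> A" "q \<in> B"
        using pq by blast
      then obtain E where "E \<in> C" "p \<in> E" "q \<in> E"
        using chain[of A B] by auto
      then show ?thesis
        using C(2)[of E] pq by (simp add: antichain_below_def)
    qed
    moreover have "\<Union>C \<subseteq> D"
      using C(1) by (rule Union_least)
    ultimately show "\<Union>C \<in> ?\<A>"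
      using D by (auto simp: antichain_below_def)
  qed
  then obtain V where V: "V \<subseteq> D" "antichain_below Q r X V"
    and max: "\<And>W. W \<subseteq> D \<Longrightarrow> antichain_below Q r X W \<Longrightarrow> V \<subseteq> W \<Longrightarrow> W = V"
    by auto
  have "A = V" if A: "antichain_below Q r X A" "V \<subseteq> A" for A
  proof (rule ccontr)
    assume "A \<noteq> V"
    then obtain a where a: "a \<in> A" "a \<notin> V"
      using A by blast
    then have a_Q: "a \<in> Q" "(a, X) \<in> r"
      using A by (auto simp: antichain_below_def)
    then obtain d where d: "d \<in> D" "(d, a) \<in> r"
      using dense by blast
    have d_Q: "d \<in> Q"
      using d D by blast
    have comp_mono: "compatible Q r a v" if "compatible Q r d v \<or> compatible Q r v d" for v
      using that transD[OF trans _ d(2)] by (auto simp: compatible_def)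
    have incomp: "\<not> compatible Q r d v \<and> \<not> compatible Q r v d" if "v \<in> V" for v
    proof -
      have "v \<in> A" "a \<noteq> v"
        using A(2) a(2) that by auto
      then have "\<not> compatible Q r a v"
        using A(1) a(1) by (simp add: antichain_below_def)
      then show ?thesis
        using comp_mono by blast
    qed
    then have "antichain_below Q r X (insert d V)"
      using V d D by (auto simp: antichain_below_def)
    then have "insert d V = V"
      using max[of "insert d V"] V d by (simp add: subset_insertI)
    then have "\<not> compatible Q r d d"
      using incomp by blast
    then show False
      using refl[OF d_Q] d_Q by (auto simp: compatible_def)
  qed
  then show ?thesis
    using V that by (simp add: maximal_antichain_below_def)
qed

lemma maximal_antichain_singleton:
  assumes "\<And>q. q \<in> Q \<Longrightarrow> (q, q) \<in> r" "X \<in> Q"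
  shows "maximal_antichain_below Q r X {X}"
  using assms unfolding maximal_antichain_below_def antichain_below_def compatible_def by blast

section \<open>From Nonempty to Choose\<close>

text \<open>
  The predicate \<open>L\<close> abstracts the winning condition at the end of a game; monotonicity is what lets
  a win be transferred from one set of moves to a set of larger ones.
\<close>

locale game_setting = unbounded_well_order \<kappa>
  for \<kappa> :: "'k rel" +
  fixes \<gamma> :: 'k and Q :: "'q set" and r :: "'q rel" and L :: "'q set \<Rightarrow> bool"
  assumes limit_length: "limit_ordinal \<kappa> \<gamma>"
    and refl: "q \<in> Q \<Longrightarrow> (q, q) \<in> r"
    and trans: "trans r"
    and win_mono: "L A \<Longrightarrow> (\<And>b. b \<in> B \<Longrightarrow> \<exists>a\<in>A. (a, b) \<in> r) \<Longrightarrow> L B"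
begin

abbreviation nonempty_winning :: "('k \<Rightarrow> ('k \<Rightarrow> 'q) \<Rightarrow> 'q) \<Rightarrow> bool" where
  "nonempty_winning \<equiv> bm_nonempty_winning \<kappa> Q (\<lambda>x y. (x, y) \<in> r) \<gamma> (\<lambda>p. L (p ` underS \<gamma>))"

text \<open>
  In the poset of positive sets the first conjunct says that the intersections of the picks stay
  positive. Where \<open>L\<close> itself asks for a lower bound, it is implied by the second conjunct.
\<close>

definition choose_won :: "('k \<Rightarrow> 'q) \<Rightarrow> bool" where
  "choose_won c \<longleftrightarrow>
     (\<forall>\<delta>\<in>underS \<gamma>. \<exists>q\<in>Q. \<forall>\<alpha>\<in>under \<delta>. (q, c \<alpha>) \<in> r) \<and> L (c ` underS \<gamma>)"

abbreviation choose_winning :: "'q \<Rightarrow> ('k \<Rightarrow> ('k \<Rightarrow> 'q set) \<Rightarrow> ('k \<Rightarrow> 'q) \<Rightarrow> 'q) \<Rightarrow> bool" where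
  "choose_winning X \<equiv> cc_choose_winning \<kappa> (maximal_antichain_below Q r X) \<gamma> choose_won"

lemma first_less_length: "first \<in> underS \<gamma>"
  using limit_underS[OF limit_length] first_less by auto

lemma le_trans: "(x, y) \<in> r \<Longrightarrow> (y, z) \<in> r \<Longrightarrow> (x, z) \<in> r"
  using trans by (rule transD)

text \<open>
  Choose's private play against \<open>\<tau>\<close> when Cut plays \<open>W\<close>. At the stage \<open>e \<alpha>\<close> Empty moves below an
  element of \<open>W \<alpha>\<close>; at the opening stage the condition amounts to playing below \<open>X\<close>.
\<close>

definition simulated_play ::
  "('k \<Rightarrow> 'k) \<Rightarrow> ('k \<Rightarrow> ('k \<Rightarrow> 'q) \<Rightarrow> 'q) \<Rightarrow> 'q \<Rightarrow> ('k \<Rightarrow> 'q set) \<Rightarrow> 'k \<Rightarrow> 'q" where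
  "simulated_play e \<tau> X W = wo_rec (\<lambda>s h.
     if nonempty_moves_at \<kappa> s then \<tau> s h
     else SOME x. x \<in> Q \<and> (x, X) \<in> r \<and> (\<forall>t\<in>underS s. (x, h t) \<in> r) \<and>
       (\<forall>\<alpha>\<in>underS \<gamma>. e \<alpha> = s \<longrightarrow> (\<exists>A\<in>W \<alpha>. (x, A) \<in> r)))"

lemma simulated_play_nonempty:
  "nonempty_moves_at \<kappa> s \<Longrightarrow>
   simulated_play e \<tau> X W s = \<tau> s (restrict (simulated_play e \<tau> X W) (underS s))"
  unfolding simulated_play_def by (subst wo_rec) simp

lemma simulated_play_empty:
  assumes "empty_moves_at \<kappa> s" "x \<in> Q" "(x, X) \<in> r"
    "\<And>t. t \<in> underS s \<Longrightarrow> (x, simulated_play e \<tau> X W t) \<in> r"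
    "\<And>\<alpha>. \<alpha> \<in> underS \<gamma> \<Longrightarrow> e \<alpha> = s \<Longrightarrow> \<exists>A\<in>W \<alpha>. (x, A) \<in> r"
  defines "p \<equiv> simulated_play e \<tau> X W"
  shows "p s \<in> Q \<and> (p s, X) \<in> r \<and> (\<forall>t\<in>underS s. (p s, p t) \<in> r) \<and>
    (\<forall>\<alpha>\<in>underS \<gamma>. e \<alpha> = s \<longrightarrow> (\<exists>A\<in>W \<alpha>. (p s, A) \<in> r))"
proof -
  have *: "p s = (SOME x. x \<in> Q \<and> (x, X) \<in> r \<and> (\<forall>t\<in>underS s. (x, p t) \<in> r) \<and>
       (\<forall>\<alpha>\<in>underS \<gamma>. e \<alpha> = s \<longrightarrow> (\<exists>A\<in>W \<alpha>. (x, A) \<in> r)))"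
    using moves_exclusive(1)[OF assms(1)]
    unfolding p_def simulated_play_def by (subst wo_rec) simp
  show ?thesis
    unfolding * by (rule someI[of _ x]) (use assms in auto)
qed

text \<open>
  Empty never gets stuck: each of Empty's later stages directly follows a move of Nonempty, which
  is below \<open>X\<close> and so has a common extension with an element of any maximal antichain below \<open>X\<close>.
\<close>

lemma simulated_play_legal:
  assumes \<tau>: "nonempty_winning \<tau>" and X: "X \<in> Q"
    and W: "\<And>\<alpha>. \<alpha> \<in> underS \<gamma> \<Longrightarrow> maximal_antichain_below Q r X (W \<alpha>)"
    and e_succ: "\<And>\<alpha>. \<alpha> \<in> Field \<kappa> \<Longrightarrow> \<exists>\<nu>. nonempty_moves_at \<kappa> \<nu> \<and> e \<alpha> = succ \<nu>"
    and e_mono: "\<And>\<alpha> \<beta>. \<beta> \<in> underS \<alpha> \<Longrightarrow> e \<beta> \<in> underS (e \<alpha>)"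
    and s: "s \<in> underS \<gamma>"
  defines "p \<equiv> simulated_play e \<tau> X W"
  shows "p s \<in> Q \<and> (p s, X) \<in> r \<and> (\<forall>t\<in>underS s. (p s, p t) \<in> r) \<and>
    (\<forall>\<alpha>\<in>underS \<gamma>. e \<alpha> = s \<longrightarrow> (\<exists>A\<in>W \<alpha>. (p s, A) \<in> r))"
proof -
  have "s \<in> Field \<kappa>" using s less_Field by metis
  then show ?thesis using s
  proof (induction s rule: less_induct)
    case (less s)
    have below: "p t \<in> Q \<and> (p t, X) \<in> r \<and> (\<forall>u\<in>underS t. (p t, p u) \<in> r)" if "t \<in> underS s" for t
      using less.IH[OF that less_trans[OF that less.prems]] by blast
    then have play: "bm_play \<kappa> Q (\<lambda>x y. (x, y) \<in> r) s p"
      by (auto simp: bm_play_def bm_legal_move_def)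
    have follows: "bm_follows \<kappa> \<tau> s p"
      by (auto simp: bm_follows_def p_def simulated_play_nonempty)
    show ?case
    proof (cases "nonempty_moves_at \<kappa> s")
      case True
      have "bm_legal_move \<kappa> Q (\<lambda>x y. (x, y) \<in> r) s p (\<tau> s (restrict p (underS s)))"
        using \<tau> less.prems True play follows by (auto simp: bm_nonempty_winning_def)
      then have legal: "p s \<in> Q" "\<forall>t\<in>underS s. (p s, p t) \<in> r"
        using simulated_play_nonempty[OF True] by (auto simp: bm_legal_move_def p_def)
      moreover have "(p s, X) \<in> r"
        using legal(2) below[of first] le_trans[of "p s" "p first" X] nonempty_move_not_first[OF True]
        by simp
      moreover have "e \<alpha> \<noteq> s" if "\<alpha> \<in> underS \<gamma>" for \<alpha>
        using e_succ[of \<alpha>] that less_Field[of \<alpha> \<gamma>] moves_exclusive(2)[OF True]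
          empty_moves_at_nonempty_moves_at.suc_nonempty by metis
      ultimately show ?thesis
        by blast
    next
      case False
      then have empty: "empty_moves_at \<kappa> s"
        using moves_total less.hyps by blast
      then consider "s = first" | \<nu> where "nonempty_moves_at \<kappa> \<nu>" "s = succ \<nu>"
        using empty_moves_iff less.hyps by blast
      then show ?thesis
      proof cases
        case 1
        have "e \<alpha> \<noteq> s" if "\<alpha> \<in> underS \<gamma>" for \<alpha>
          using e_succ[of \<alpha>] that less_Field[of \<alpha> \<gamma>] 1 underS_first moves_Field(2)
            underS_succ_nonempty by metis
        then show ?thesis
          unfolding p_def
          by (intro simulated_play_empty[OF empty X refl[OF X]]) (use 1 underS_first in auto)
      next
        case 2
        then have \<nu>: "\<nu> \<in> underS s" "underS s = insert \<nu> (underS \<nu>)"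
          using moves_Field less_succ underS_succ under_eq by metis+
        have le_below: "(x, p t) \<in> r" if "(x, p \<nu>) \<in> r" "t \<in> underS s" for x t
          using that(1) that(2)[unfolded \<nu>(2)] below[OF \<nu>(1)] le_trans[OF that(1), of "p t"] by auto
        show ?thesis
        proof (cases "\<exists>\<alpha>\<in>underS \<gamma>. e \<alpha> = s")
          case True
          then obtain \<alpha> where \<alpha>: "\<alpha> \<in> underS \<gamma>" "e \<alpha> = s"
            by blast
          \<comment> \<open>A stage serves one round, so one common extension meets the condition for every \<open>\<beta>\<close>.\<close>
          have unique: "\<beta> = \<alpha>" if "\<beta> \<in> underS \<gamma>" "e \<beta> = s" for \<beta>
          proof -
            have "\<alpha> \<notin> underS \<beta>" "\<beta> \<notin> underS \<alpha>"
              using e_mono[of \<alpha> \<beta>] e_mono[of \<beta> \<alpha>] \<alpha>(2) that(2) less_asym[of s s] by auto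
            then show ?thesis
              using less_linear[of \<alpha> \<beta>] less_Field[OF \<alpha>(1)] less_Field[OF that(1)] by simp
          qed
          obtain A x where x: "A \<in> W \<alpha>" "x \<in> Q" "(x, p \<nu>) \<in> r" "(x, A) \<in> r"
            using maximal_antichain_meets[OF refl W[OF \<alpha>(1)], of "p \<nu>"] below[OF \<nu>(1)]
            by (auto simp: compatible_def)
          show ?thesis
            unfolding p_def
          proof (intro simulated_play_empty[OF empty x(2)])
            show "(x, X) \<in> r"
              using le_trans[OF x(3)] below[OF \<nu>(1)] by simp
            show "(x, simulated_play e \<tau> X W t) \<in> r" if "t \<in> underS s" for t
              using le_below[OF x(3) that] by (simp add: p_def)
            show "\<exists>A\<in>W \<beta>. (x, A) \<in> r" if "\<beta> \<in> underS \<gamma>" "e \<beta> = s" for \<beta>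
              using x(1,4) unique[OF that] by auto
          qed
        next
          case False
          have "p \<nu> \<in> Q" "(p \<nu>, X) \<in> r"
            using below[OF \<nu>(1)] by auto
          then show ?thesis
            using simulated_play_empty[OF empty, of "p \<nu>" X e \<tau> W] False le_below[OF refl]
            by (auto simp: p_def)
        qed
      qed
    qed
  qed
qed

text \<open>
  Up to the stage \<open>e \<alpha>\<close> the private play consults only antichains of rounds up to \<open>\<alpha>\<close>, because \<open>e\<close>
  is strictly increasing. Hence Choose can compute it when picking in round \<open>\<alpha>\<close>.
\<close>

lemma simulated_play_local:
  assumes e_mono: "\<And>\<alpha> \<beta>. \<beta> \<in> underS \<alpha> \<Longrightarrow> e \<beta> \<in> underS (e \<alpha>)"
    and "\<alpha> \<in> Field \<kappa>" "e \<alpha> \<in> Field \<kappa>"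
  shows "simulated_play e \<tau> X (restrict W (under \<alpha>)) (e \<alpha>) = simulated_play e \<tau> X W (e \<alpha>)"
  unfolding simulated_play_def
proof (rule wo_rec_cong[OF assms(3)])
  fix s and h :: "'k \<Rightarrow> 'q"
  assume s: "s \<in> under (e \<alpha>)"
  have "\<beta> \<in> under \<alpha>" if "\<beta> \<in> Field \<kappa>" "e \<beta> = s" for \<beta>
  proof (rule ccontr)
    assume "\<beta> \<notin> under \<alpha>"
    then have "\<alpha> \<in> underS \<beta>"
      using less_linear[OF that(1) assms(2)] under_eq[OF assms(2)] by auto
    then show False
      using e_mono[of \<alpha> \<beta>] s that under_eq[OF assms(3)] less_asym[of "e \<alpha>" s]
      by (auto simp: Order_Relation.underS_def)
  qed
  then have "e \<beta> = s \<longrightarrow> restrict W (under \<alpha>) \<beta> = W \<beta>" if "\<beta> \<in> underS \<gamma>" for \<beta>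
    using less_Field[OF that] by auto
  then have "(\<forall>\<beta>\<in>underS \<gamma>. e \<beta> = s \<longrightarrow> (\<exists>A\<in>restrict W (under \<alpha>) \<beta>. (x, A) \<in> r))
      \<longleftrightarrow> (\<forall>\<beta>\<in>underS \<gamma>. e \<beta> = s \<longrightarrow> (\<exists>A\<in>W \<beta>. (x, A) \<in> r))" for x
    by (intro ball_cong) auto
  then show "(if nonempty_moves_at \<kappa> s then \<tau> s h
     else SOME x. x \<in> Q \<and> (x, X) \<in> r \<and> (\<forall>t\<in>underS s. (x, h t) \<in> r) \<and>
       (\<forall>\<beta>\<in>underS \<gamma>. e \<beta> = s \<longrightarrow> (\<exists>A\<in>restrict W (under \<alpha>) \<beta>. (x, A) \<in> r)))
    = (if nonempty_moves_at \<kappa> s then \<tau> s h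
     else SOME x. x \<in> Q \<and> (x, X) \<in> r \<and> (\<forall>t\<in>underS s. (x, h t) \<in> r) \<and>
       (\<forall>\<beta>\<in>underS \<gamma>. e \<beta> = s \<longrightarrow> (\<exists>A\<in>W \<beta>. (x, A) \<in> r)))"
    by simp
qed

theorem nonempty_wins_imp_choose_wins:
  assumes \<tau>: "nonempty_winning \<tau>" and X: "X \<in> Q"
  shows "\<exists>\<sigma>. choose_winning X \<sigma>"
proof -
  obtain e :: "'k \<Rightarrow> 'k"
    where e_succ: "\<And>\<alpha>. \<alpha> \<in> Field \<kappa> \<Longrightarrow> \<exists>\<nu>. nonempty_moves_at \<kappa> \<nu> \<and> e \<alpha> = succ \<nu>"
      and e_mono: "\<And>\<alpha> \<beta>. \<beta> \<in> underS \<alpha> \<Longrightarrow> e \<beta> \<in> underS (e \<alpha>)"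
      and e_limit: "\<And>\<alpha> \<mu>. limit_ordinal \<kappa> \<mu> \<Longrightarrow> \<alpha> \<in> underS \<mu> \<Longrightarrow> e \<alpha> \<in> underS \<mu>"
    by (rule ex_round_stage) blast
  define \<sigma> where "\<sigma> \<alpha> W c = (SOME A. A \<in> W \<alpha> \<and> (simulated_play e \<tau> X W (e \<alpha>), A) \<in> r)"
    for \<alpha> W and c :: "'k \<Rightarrow> 'q"
  have "(\<forall>\<alpha>\<in>underS \<gamma>. c \<alpha> \<in> W \<alpha>) \<and> choose_won c"
    if W: "\<And>\<alpha>. \<alpha> \<in> underS \<gamma> \<Longrightarrow> maximal_antichain_below Q r X (W \<alpha>)"
      and c: "\<And>\<alpha>. \<alpha> \<in> underS \<gamma> \<Longrightarrow> c \<alpha> = \<sigma> \<alpha> (restrict W (under \<alpha>)) (restrict c (underS \<alpha>))"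
    for W c
  proof -
    define p where "p = simulated_play e \<tau> X W"
    have e_less: "e \<alpha> \<in> underS \<gamma>" if "\<alpha> \<in> underS \<gamma>" for \<alpha>
      using e_limit limit_length that by blast
    have legal: "p s \<in> Q \<and> (\<forall>t\<in>underS s. (p s, p t) \<in> r) \<and>
        (\<forall>\<alpha>\<in>underS \<gamma>. e \<alpha> = s \<longrightarrow> (\<exists>A\<in>W \<alpha>. (p s, A) \<in> r))" if "s \<in> underS \<gamma>" for s
      using simulated_play_legal[where e = e and W = W, OF \<tau> X W e_succ e_mono that]
      by (simp add: p_def)
    have c_props: "c \<alpha> \<in> W \<alpha> \<and> (p (e \<alpha>), c \<alpha>) \<in> r" if "\<alpha> \<in> underS \<gamma>" for \<alpha>
    proof -
      have "\<alpha> \<in> under \<alpha>" "\<alpha> \<in> Field \<kappa>" "e \<alpha> \<in> Field \<kappa>"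
        using less_Field[OF that] less_Field[OF e_less[OF that]] under_eq by auto
      then have "c \<alpha> = (SOME A. A \<in> W \<alpha> \<and> (p (e \<alpha>), A) \<in> r)"
        using c[OF that] simulated_play_local[where e = e and \<alpha> = \<alpha>, OF e_mono] by (simp add: \<sigma>_def p_def)
      moreover have "\<exists>A. A \<in> W \<alpha> \<and> (p (e \<alpha>), A) \<in> r"
        using legal[OF e_less[OF that]] that by blast
      ultimately show ?thesis
        by (metis (mono_tags, lifting) someI_ex)
    qed
    have "bm_play \<kappa> Q (\<lambda>x y. (x, y) \<in> r) \<gamma> p"
      using legal by (auto simp: bm_play_def bm_legal_move_def)
    moreover have "bm_follows \<kappa> \<tau> \<gamma> p"
      by (auto simp: bm_follows_def p_def simulated_play_nonempty)
    ultimately have "L (p ` underS \<gamma>)"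
      using \<tau> by (auto simp: bm_nonempty_winning_def)
    then have "L (c ` underS \<gamma>)"
      by (rule win_mono) (use c_props e_less in blast)
    moreover have "\<exists>q\<in>Q. \<forall>\<alpha>\<in>under \<delta>. (q, c \<alpha>) \<in> r" if "\<delta> \<in> underS \<gamma>" for \<delta>
    proof (intro bexI ballI)
      show "p (e \<delta>) \<in> Q"
        using legal[OF e_less[OF that]] by blast
    next
      fix \<alpha> assume \<alpha>: "\<alpha> \<in> under \<delta>"
      then have "\<alpha> = \<delta> \<or> e \<alpha> \<in> underS (e \<delta>)"
        using under_eq[of \<delta>] less_Field[OF that] e_mono by auto
      then have "(p (e \<delta>), p (e \<alpha>)) \<in> r"
        using legal[OF e_less[OF that]] refl by blast
      moreover have "\<alpha> \<in> underS \<gamma>"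
        using \<alpha> under_subset_underS[OF that] by blast
      ultimately show "(p (e \<delta>), c \<alpha>) \<in> r"
        using c_props le_trans[of "p (e \<delta>)" "p (e \<alpha>)" "c \<alpha>"] by simp
    qed
    ultimately show ?thesis
      using c_props by (auto simp: choose_won_def)
  qed
  then show ?thesis
    unfolding cc_choose_winning_def by blast
qed

section \<open>From Choose to Nonempty\<close>

text \<open>Choose's pick in round \<open>\<alpha>\<close> after the history \<open>W\<close>, \<open>c\<close>, should Cut now play \<open>V\<close>.\<close>

definition answer ::
  "('k \<Rightarrow> ('k \<Rightarrow> 'q set) \<Rightarrow> ('k \<Rightarrow> 'q) \<Rightarrow> 'q) \<Rightarrow> ('k \<Rightarrow> 'q set) \<Rightarrow> ('k \<Rightarrow> 'q) \<Rightarrow> 'k \<Rightarrow> 'q set \<Rightarrow> 'q"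
  where "answer \<sigma> W c \<alpha> V = \<sigma> \<alpha> (restrict (W(\<alpha> := V)) (under \<alpha>)) (restrict c (underS \<alpha>))"

definition consistent ::
  "'q \<Rightarrow> ('k \<Rightarrow> ('k \<Rightarrow> 'q set) \<Rightarrow> ('k \<Rightarrow> 'q) \<Rightarrow> 'q) \<Rightarrow> ('k \<Rightarrow> 'q set) \<Rightarrow> ('k \<Rightarrow> 'q) \<Rightarrow> 'k \<Rightarrow> bool"
  where "consistent X \<sigma> W c \<alpha> \<longleftrightarrow>
    (\<forall>\<beta>\<in>underS \<alpha>. maximal_antichain_below Q r X (W \<beta>) \<and> c \<beta> = answer \<sigma> W c \<beta> (W \<beta>))"

lemma answer_cong:
  assumes "\<alpha> \<in> Field \<kappa>"
    and "\<And>\<beta>. \<beta> \<in> underS \<alpha> \<Longrightarrow> W \<beta> = W' \<beta>" "\<And>\<beta>. \<beta> \<in> underS \<alpha> \<Longrightarrow> c \<beta> = c' \<beta>"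
  shows "answer \<sigma> W c \<alpha> V = answer \<sigma> W' c' \<alpha> V"
proof -
  have "restrict (W(\<alpha> := V)) (under \<alpha>) = restrict (W'(\<alpha> := V)) (under \<alpha>)"
    using assms(2) under_eq[OF assms(1)] by (auto simp: restrict_def fun_eq_iff)
  moreover have "restrict c (underS \<alpha>) = restrict c' (underS \<alpha>)"
    using assms(3) by (auto simp: restrict_def)
  ultimately show ?thesis
    by (simp add: answer_def)
qed

lemma answer_actual: "answer \<sigma> W c \<alpha> (W \<alpha>) = \<sigma> \<alpha> (restrict W (under \<alpha>)) (restrict c (underS \<alpha>))"
  by (simp add: answer_def)

text \<open>
  A winning strategy cannot leave a position without lower bound: Cut could complete the run by
  trivial antichains \<open>{X}\<close> and win.
\<close>

lemma answer_compatible: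
  assumes \<sigma>: "choose_winning X \<sigma>" and X: "X \<in> Q" and \<alpha>: "\<alpha> \<in> underS \<gamma>"
    and run: "consistent X \<sigma> W c \<alpha>" and V: "maximal_antichain_below Q r X V"
  shows "answer \<sigma> W c \<alpha> V \<in> V \<and>
    (\<exists>q\<in>Q. (\<forall>\<beta>\<in>underS \<alpha>. (q, c \<beta>) \<in> r) \<and> (q, answer \<sigma> W c \<alpha> V) \<in> r)"
proof -
  have \<alpha>_Field: "\<alpha> \<in> Field \<kappa>"
    using less_Field[OF \<alpha>] by simp
  define W' where "W' \<beta> = (if \<beta> \<in> underS \<alpha> then W \<beta> else if \<beta> = \<alpha> then V else {X})" for \<beta>
  define c' where "c' = wo_rec (\<lambda>\<beta> h. \<sigma> \<beta> (restrict W' (under \<beta>)) h)"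
  have c': "c' \<beta> = answer \<sigma> W' c' \<beta> (W' \<beta>)" for \<beta>
    unfolding answer_actual unfolding c'_def by (subst wo_rec) simp
  have W'_less: "W' \<beta> = W \<beta>" if "\<beta> \<in> underS \<alpha>" for \<beta>
    using that by (simp add: W'_def)
  have W'_self: "W' \<alpha> = V"
    by (simp add: W'_def Order_Relation.underS_def)
  have c'_less: "c' \<beta> = c \<beta>" if "\<beta> \<in> underS \<alpha>" for \<beta>
  proof -
    have "\<beta> \<in> Field \<kappa>"
      using less_Field[OF that] by simp
    then show ?thesis using that
    proof (induction \<beta> rule: less_induct)
      case (less \<beta>)
      have "answer \<sigma> W' c' \<beta> (W' \<beta>) = answer \<sigma> W c \<beta> (W' \<beta>)"
        using less.hyps
      proof (rule answer_cong)
        fix \<delta> assume \<delta>: "\<delta> \<in> underS \<beta>"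
        have "\<delta> \<in> underS \<alpha>"
          using less_trans[OF \<delta> less.prems] .
        then show "W' \<delta> = W \<delta>" "c' \<delta> = c \<delta>"
          using W'_less less.IH[OF \<delta>] by auto
      qed
      then show ?case
        using c'[of \<beta>] run less.prems W'_less by (simp add: consistent_def)
    qed
  qed
  have c'_self: "c' \<alpha> = answer \<sigma> W c \<alpha> V"
    using c'[of \<alpha>] answer_cong[OF \<alpha>_Field W'_less c'_less] W'_self by simp
  have "maximal_antichain_below Q r X (W' \<beta>)" for \<beta>
    using run V maximal_antichain_singleton[OF refl X] by (auto simp: W'_def consistent_def)
  moreover have "c' \<beta> = \<sigma> \<beta> (restrict W' (under \<beta>)) (restrict c' (underS \<beta>))" for \<beta>
    using c'[of \<beta>] by (simp only: answer_actual)
  ultimately have won: "c' \<alpha> \<in> W' \<alpha>" "choose_won c'"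
    using \<sigma> \<alpha> unfolding cc_choose_winning_def by blast+
  then obtain q where "q \<in> Q" "\<forall>\<beta>\<in>under \<alpha>. (q, c' \<beta>) \<in> r"
    using \<alpha> unfolding choose_won_def by blast
  then have "q \<in> Q" "\<forall>\<beta>\<in>underS \<alpha>. (q, c \<beta>) \<in> r" "(q, answer \<sigma> W c \<alpha> V) \<in> r"
    using under_eq[OF \<alpha>_Field] c'_less c'_self by simp_all
  then show ?thesis
    using won(1) c'_self W'_self by auto
qed

definition all_below_answers ::
  "'q \<Rightarrow> ('k \<Rightarrow> ('k \<Rightarrow> 'q set) \<Rightarrow> ('k \<Rightarrow> 'q) \<Rightarrow> 'q) \<Rightarrow> ('k \<Rightarrow> 'q set) \<Rightarrow> ('k \<Rightarrow> 'q) \<Rightarrow> 'k \<Rightarrow> 'q \<Rightarrow> bool"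
  where "all_below_answers X \<sigma> W c \<alpha> y \<longleftrightarrow>
    (\<forall>z\<in>Q. (z, y) \<in> r \<longrightarrow> (\<exists>V. maximal_antichain_below Q r X V \<and> answer \<sigma> W c \<alpha> V = z))"

text \<open>
  The key step. If every lower bound of the previous picks had an extension that \<open>\<sigma>\<close> never answers
  with, Cut could play a maximal antichain consisting only of such extensions and of elements that
  are incompatible with the position. By \<open>answer_compatible\<close> the answer would have to be one of
  the former.
\<close>

lemma ex_all_below_answers:
  assumes \<sigma>: "choose_winning X \<sigma>" and X: "X \<in> Q" and \<alpha>: "\<alpha> \<in> underS \<gamma>"
    and run: "consistent X \<sigma> W c \<alpha>"
  shows "\<exists>y\<in>Q. (\<forall>\<beta>\<in>underS \<alpha>. (y, c \<beta>) \<in> r) \<and> all_below_answers X \<sigma> W c \<alpha> y"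
proof (rule ccontr)
  assume none: "\<not> ?thesis"
  define lower where "lower = {q \<in> Q. \<forall>\<beta>\<in>underS \<alpha>. (q, c \<beta>) \<in> r}"
  define bad where
    "bad = {z \<in> Q. \<forall>V. maximal_antichain_below Q r X V \<longrightarrow> answer \<sigma> W c \<alpha> V \<noteq> z}"
  define D where "D = {A \<in> Q. (A, X) \<in> r \<and> (A \<in> bad \<or> (\<forall>q\<in>lower. (q, A) \<notin> r))}"
  have "\<exists>d\<in>D. (d, q) \<in> r" if q: "q \<in> Q" "(q, X) \<in> r" for q
  proof (cases "\<exists>y\<in>lower. (y, q) \<in> r")
    case True
    then obtain y where y: "y \<in> lower" "(y, q) \<in> r"
      by blast
    then have "\<not> all_below_answers X \<sigma> W c \<alpha> y"
      using none by (auto simp: lower_def)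
    then obtain z where z: "z \<in> bad" "(z, y) \<in> r"
      by (auto simp: all_below_answers_def bad_def)
    then have "(z, q) \<in> r"
      using y le_trans[of z y q] by simp
    then show ?thesis
      using z(1) le_trans[of z q X] q(2) by (auto simp: D_def bad_def)
  next
    case False
    then show ?thesis
      using q refl[OF q(1)] by (auto simp: D_def)
  qed
  moreover have "D \<subseteq> {q \<in> Q. (q, X) \<in> r}"
    by (auto simp: D_def)
  ultimately obtain V where V: "V \<subseteq> D" "maximal_antichain_below Q r X V"
    using maximal_antichain_in_dense[where D = D and X = X, OF refl trans] by blast
  have "answer \<sigma> W c \<alpha> V \<in> bad"
    using answer_compatible[OF \<sigma> X \<alpha> run V(2)] V(1) by (auto simp: D_def lower_def)
  then show False
    using V(2) by (auto simp: bad_def)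
qed

text \<open>
  The private cut-and-choose run reconstructed from a play \<open>p\<close>. Rounds are stages: in the rounds of
  Nonempty's stages and in round zero Cut plays \<open>{X}\<close>, which forces the pick \<open>X\<close>; in the rounds of
  Empty's later stages Cut plays an antichain that \<open>\<sigma>\<close> answers by Empty's actual move.
\<close>

definition choices :: "'q \<Rightarrow> ('k \<Rightarrow> 'q) \<Rightarrow> 'k \<Rightarrow> 'q" where
  "choices X p s = (if empty_moves_at \<kappa> s then p s else X)"

definition cut_moves ::
  "'q \<Rightarrow> ('k \<Rightarrow> ('k \<Rightarrow> 'q set) \<Rightarrow> ('k \<Rightarrow> 'q) \<Rightarrow> 'q) \<Rightarrow> ('k \<Rightarrow> 'q) \<Rightarrow> 'k \<Rightarrow> 'q set" where
  "cut_moves X \<sigma> p = wo_rec (\<lambda>s w.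
     if empty_moves_at \<kappa> s \<and> s \<noteq> first
     then SOME V. maximal_antichain_below Q r X V \<and> answer \<sigma> w (choices X p) s V = p s
     else {X})"

lemma cut_moves_singleton:
  "nonempty_moves_at \<kappa> s \<or> s = first \<Longrightarrow> cut_moves X \<sigma> p s = {X}"
  using moves_exclusive(2) unfolding cut_moves_def by (subst wo_rec) auto

lemma cut_moves_empty:
  assumes "empty_moves_at \<kappa> s" "s \<noteq> first"
    and "\<exists>V. maximal_antichain_below Q r X V \<and> answer \<sigma> (cut_moves X \<sigma> p) (choices X p) s V = p s"
  shows "maximal_antichain_below Q r X (cut_moves X \<sigma> p s) \<and>
    answer \<sigma> (cut_moves X \<sigma> p) (choices X p) s (cut_moves X \<sigma> p s) = p s"
proof -
  have "answer \<sigma> (restrict (cut_moves X \<sigma> p) (underS s)) (choices X p) s V =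
      answer \<sigma> (cut_moves X \<sigma> p) (choices X p) s V" for V
    using moves_Field(1)[OF assms(1)] by (rule answer_cong) simp_all
  then have "cut_moves X \<sigma> p s = (SOME V. maximal_antichain_below Q r X V \<and>
      answer \<sigma> (cut_moves X \<sigma> p) (choices X p) s V = p s)"
    using assms(1,2) unfolding cut_moves_def by (subst wo_rec) simp
  then show ?thesis
    using someI_ex[OF assms(3)] by simp
qed

text \<open>
  At one of Nonempty's own stages \<open>\<alpha>\<close> the reconstructed round is \<open>{X}\<close>, whatever is played there.
  So Nonempty knows the reconstructed run through round \<open>\<alpha>\<close> already before moving at \<open>\<alpha>\<close>, and
  can prepare for the answer in round \<open>\<alpha> + 1\<close>, where Empty moves.
\<close>

lemma position_cong:
  assumes \<alpha>: "nonempty_moves_at \<kappa> \<alpha>" and pp': "\<And>t. t \<in> underS \<alpha> \<Longrightarrow> p t = p' t"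
    and s: "s \<in> under \<alpha>"
  shows "choices X p s = choices X p' s" "cut_moves X \<sigma> p s = cut_moves X \<sigma> p' s"
proof -
  have \<alpha>_Field: "\<alpha> \<in> Field \<kappa>"
    using moves_Field(2)[OF \<alpha>] .
  have empty: "p t = p' t" if "empty_moves_at \<kappa> t" "t \<in> under \<alpha>" for t
  proof -
    have "t \<noteq> \<alpha>"
      using moves_exclusive(2)[OF \<alpha>] that(1) by auto
    then show ?thesis
      using pp' that(2) under_eq[OF \<alpha>_Field] by auto
  qed
  then have choices: "choices X p t = choices X p' t" if "t \<in> under \<alpha>" for t
    using that by (simp add: choices_def)
  then show "choices X p s = choices X p' s"
    using s by blast
  have s_Field: "s \<in> Field \<kappa>"
    using s by (auto simp: Order_Relation.under_def Field_def)
  show "cut_moves X \<sigma> p s = cut_moves X \<sigma> p' s"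
    unfolding cut_moves_def
  proof (rule wo_rec_cong[OF s_Field])
    fix \<beta> and w :: "'k \<Rightarrow> 'q set"
    assume "\<beta> \<in> under s"
    then have \<beta>: "\<beta> \<in> under \<alpha>"
      using under_trans[OF _ s] by blast
    have "answer \<sigma> w (choices X p) \<beta> V = answer \<sigma> w (choices X p') \<beta> V"
      if "empty_moves_at \<kappa> \<beta>" for V
      using moves_Field(1)[OF that]
      by (rule answer_cong) (use choices underS_subset_under[OF \<beta>] in auto)
    then show "(if empty_moves_at \<kappa> \<beta> \<and> \<beta> \<noteq> first
       then SOME V. maximal_antichain_below Q r X V \<and> answer \<sigma> w (choices X p) \<beta> V = p \<beta>
       else {X}) =
      (if empty_moves_at \<kappa> \<beta> \<and> \<beta> \<noteq> first
       then SOME V. maximal_antichain_below Q r X V \<and> answer \<sigma> w (choices X p') \<beta> V = p' \<beta>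
       else {X})"
      using empty[OF _ \<beta>] by simp
  qed
qed

text \<open>The family \<open>\<Sigma>\<close> provides one strategy for each possible opening move of Empty, which is \<open>p first\<close>.\<close>

definition response ::
  "('q \<Rightarrow> 'k \<Rightarrow> ('k \<Rightarrow> 'q set) \<Rightarrow> ('k \<Rightarrow> 'q) \<Rightarrow> 'q) \<Rightarrow> 'k \<Rightarrow> ('k \<Rightarrow> 'q) \<Rightarrow> 'q \<Rightarrow> bool" where
  "response \<Sigma> \<alpha> p y \<longleftrightarrow> y \<in> Q \<and> (\<forall>t\<in>underS \<alpha>. (y, p t) \<in> r) \<and>
     all_below_answers (p first) (\<Sigma> (p first)) (cut_moves (p first) (\<Sigma> (p first)) p)
       (choices (p first) p) (succ \<alpha>) y"

definition nonempty_strategy ::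
  "('q \<Rightarrow> 'k \<Rightarrow> ('k \<Rightarrow> 'q set) \<Rightarrow> ('k \<Rightarrow> 'q) \<Rightarrow> 'q) \<Rightarrow> 'k \<Rightarrow> ('k \<Rightarrow> 'q) \<Rightarrow> 'q" where
  "nonempty_strategy \<Sigma> \<alpha> p = (SOME y. response \<Sigma> \<alpha> p y)"

lemma response_restrict:
  assumes "nonempty_moves_at \<kappa> \<alpha>"
  shows "response \<Sigma> \<alpha> (restrict p (underS \<alpha>)) = response \<Sigma> \<alpha> p"
proof -
  let ?h = "restrict p (underS \<alpha>)" and ?X = "p first"
  have first: "?h first = ?X"
    using nonempty_move_not_first[OF assms] by simp
  have "answer (\<Sigma> ?X) (cut_moves ?X (\<Sigma> ?X) ?h) (choices ?X ?h) (succ \<alpha>) V =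
      answer (\<Sigma> ?X) (cut_moves ?X (\<Sigma> ?X) p) (choices ?X p) (succ \<alpha>) V" for V
    using succ_Field[OF moves_Field(2)[OF assms]]
    by (rule answer_cong)
       (simp_all add: underS_succ[OF moves_Field(2)[OF assms]] position_cong[OF assms, of ?h p])
  then show ?thesis
    unfolding fun_eq_iff response_def all_below_answers_def first by simp
qed

text \<open>
  A lower bound of the reconstructed picks lies below Empty's moves; it also lies below Nonempty's
  earlier moves, since each of them was followed by a smaller move of Empty.
\<close>

lemma ex_response:
  assumes \<Sigma>: "choose_winning (p first) (\<Sigma> (p first))" and \<alpha>: "nonempty_moves_at \<kappa> \<alpha>" "\<alpha> \<in> underS \<gamma>"
    and play: "bm_play \<kappa> Q (\<lambda>x y. (x, y) \<in> r) \<alpha> p"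
    and run: "consistent (p first) (\<Sigma> (p first)) (cut_moves (p first) (\<Sigma> (p first)) p)
      (choices (p first) p) \<alpha>"
  shows "\<exists>y. response \<Sigma> \<alpha> p y"
proof -
  define X \<sigma> W c where "X = p first" and "\<sigma> = \<Sigma> X" and "W = cut_moves X \<sigma> p" and "c = choices X p"
  note defs = X_def \<sigma>_def W_def c_def
  have \<sigma>: "choose_winning X \<sigma>" and run: "consistent X \<sigma> W c \<alpha>"
    using \<Sigma> run by (simp_all add: defs)
  have \<alpha>_Field: "\<alpha> \<in> Field \<kappa>"
    using moves_Field(2)[OF \<alpha>(1)] .
  have legal: "p t \<in> Q \<and> (\<forall>u\<in>underS t. (p t, p u) \<in> r)" if "t \<in> underS \<alpha>" for t
    using play that by (auto simp: bm_play_def bm_legal_move_def)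
  have X: "X \<in> Q"
    using legal[OF nonempty_move_not_first[OF \<alpha>(1)]] by (simp add: X_def)
  have W_\<alpha>: "W \<alpha> = {X}"
    using cut_moves_singleton \<alpha>(1) by (simp add: W_def)
  have c_\<alpha>: "c \<alpha> = X"
    using moves_exclusive(2)[OF \<alpha>(1)] by (simp add: c_def choices_def)
  have "maximal_antichain_below Q r X {X}"
    using maximal_antichain_singleton[OF refl X] .
  then have "maximal_antichain_below Q r X (W \<alpha>) \<and> c \<alpha> = answer \<sigma> W c \<alpha> (W \<alpha>)"
    using answer_compatible[OF \<sigma> X \<alpha>(2) run, of "{X}"] W_\<alpha> c_\<alpha> by simp
  then have "consistent X \<sigma> W c (succ \<alpha>)"
    using run by (simp add: consistent_def underS_succ[OF \<alpha>_Field] under_eq[OF \<alpha>_Field])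
  then obtain y where y: "y \<in> Q" "\<forall>\<beta>\<in>underS (succ \<alpha>). (y, c \<beta>) \<in> r"
      "all_below_answers X \<sigma> W c (succ \<alpha>) y"
    using ex_all_below_answers[OF \<sigma> X succ_less_limit[OF limit_length \<alpha>(2)]] by blast
  have y_empty: "(y, p t) \<in> r" if "t \<in> underS \<alpha>" "empty_moves_at \<kappa> t" for t
    using bspec[OF y(2)[unfolded underS_succ[OF \<alpha>_Field]] underS_under[OF that(1)]] that(2)
    by (simp add: c_def choices_def)
  have "(y, p t) \<in> r" if t: "t \<in> underS \<alpha>" for t
  proof (cases "empty_moves_at \<kappa> t")
    case True
    then show ?thesis
      using y_empty t by blast
  next
    case False
    have t_Field: "t \<in> Field \<kappa>"
      using less_Field[OF t] by simp
    then have succ_t: "empty_moves_at \<kappa> (succ t)"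
      using False moves_total[OF t_Field] empty_moves_at_nonempty_moves_at.suc_nonempty by simp
    then have "succ t \<noteq> \<alpha>"
      using moves_exclusive(2)[OF \<alpha>(1)] by auto
    then have "succ t \<in> underS \<alpha>"
      using succ_le[OF t] under_eq[OF \<alpha>_Field] by simp
    then show ?thesis
      using y_empty[OF _ succ_t] legal[of "succ t"] less_succ[OF t_Field]
        le_trans[of y "p (succ t)" "p t"] by simp
  qed
  then have "response \<Sigma> \<alpha> p y"
    using y(1,3) by (simp add: response_def defs)
  then show ?thesis
    by (rule exI)
qed

lemma nonempty_strategy_response:
  assumes "choose_winning (p first) (\<Sigma> (p first))" "nonempty_moves_at \<kappa> \<alpha>" "\<alpha> \<in> underS \<gamma>"
    "bm_play \<kappa> Q (\<lambda>x y. (x, y) \<in> r) \<alpha> p"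
    "consistent (p first) (\<Sigma> (p first)) (cut_moves (p first) (\<Sigma> (p first)) p)
      (choices (p first) p) \<alpha>"
  shows "response \<Sigma> \<alpha> p (nonempty_strategy \<Sigma> \<alpha> (restrict p (underS \<alpha>)))"
  unfolding nonempty_strategy_def response_restrict[OF assms(2)]
  by (rule someI_ex[OF ex_response[where \<Sigma> = \<Sigma>, OF assms]])

lemma bm_play_mono:
  assumes "bm_play \<kappa> Q le \<delta> p" "\<alpha> \<in> underS \<delta>"
  shows "bm_play \<kappa> Q le \<alpha> p"
  using assms(1) less_trans[OF _ assms(2)] unfolding bm_play_def by simp

text \<open>
  By induction on the stage: Nonempty's last move guarantees that Empty's move is an answer, which
  extends the reconstructed run by one more round and so lets Nonempty find the next move.
\<close>

lemma play_consistent: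
  assumes \<Sigma>: "\<And>X. X \<in> Q \<Longrightarrow> choose_winning X (\<Sigma> X)" and \<delta>: "\<delta> \<in> under \<gamma>"
    and play: "bm_play \<kappa> Q (\<lambda>x y. (x, y) \<in> r) \<delta> p"
    and follows: "bm_follows \<kappa> (nonempty_strategy \<Sigma>) \<delta> p"
  shows "consistent (p first) (\<Sigma> (p first)) (cut_moves (p first) (\<Sigma> (p first)) p)
    (choices (p first) p) \<delta>"
proof -
  define X \<sigma> W c where "X = p first" and "\<sigma> = \<Sigma> X" and "W = cut_moves X \<sigma> p" and "c = choices X p"
  note defs = X_def \<sigma>_def W_def c_def
  have \<delta>_Field: "\<delta> \<in> Field \<kappa>"
    using \<delta> by (auto simp: Order_Relation.under_def Field_def)
  have "\<alpha> \<in> under \<delta> \<Longrightarrow> consistent X \<sigma> W c \<alpha>" if "\<alpha> \<in> Field \<kappa>" for \<alpha>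
    using that
  proof (induction \<alpha> rule: less_induct)
    case (less \<alpha>)
    have "maximal_antichain_below Q r X (W \<beta>) \<and> c \<beta> = answer \<sigma> W c \<beta> (W \<beta>)"
      if \<beta>: "\<beta> \<in> underS \<alpha>" for \<beta>
    proof -
      have \<beta>_less: "\<beta> \<in> underS \<delta>"
        using \<beta> less.prems under_eq[OF \<delta>_Field] less_trans[OF \<beta>] by auto
      have below_\<gamma>: "t \<in> underS \<gamma>" if "t \<in> underS \<delta>" for t
        using that \<delta> under_eq[OF limit_Field[OF limit_length]] less_trans[OF that] by auto
      have \<beta>_Field: "\<beta> \<in> Field \<kappa>"
        using less_Field[OF \<beta>] by simp
      have legal: "p t \<in> Q \<and> (\<forall>u\<in>underS t. (p t, p u) \<in> r)" if "t \<in> underS \<delta>" for t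
        using play that by (auto simp: bm_play_def bm_legal_move_def)
      have X: "X \<in> Q"
        using legal[OF first_less[OF \<beta>_less]] by (simp add: X_def)
      have \<sigma>: "choose_winning X \<sigma>"
        using \<Sigma>[OF X] by (simp add: \<sigma>_def)
      have run: "consistent X \<sigma> W c \<beta>"
        using less.IH[OF \<beta> underS_under[OF \<beta>_less]] .
      consider "nonempty_moves_at \<kappa> \<beta> \<or> \<beta> = first"
        | \<nu> where "nonempty_moves_at \<kappa> \<nu>" "\<beta> = succ \<nu>"
        using moves_total[OF \<beta>_Field] empty_moves_iff[OF \<beta>_Field] by blast
      then show ?thesis
      proof cases
        case 1
        then have "W \<beta> = {X}"
          by (simp add: W_def cut_moves_singleton)
        moreover have "c \<beta> = X"
          using 1 moves_exclusive(2)[of \<beta>] by (auto simp: c_def choices_def X_def)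
        moreover have "maximal_antichain_below Q r X {X}"
          using maximal_antichain_singleton[OF refl X] .
        ultimately show ?thesis
          using answer_compatible[OF \<sigma> X below_\<gamma>[OF \<beta>_less] run, of "{X}"] by simp
      next
        case 2
        have \<nu>: "\<nu> \<in> underS \<beta>"
          using 2 less_succ moves_Field(2) by simp
        have \<nu>_less: "\<nu> \<in> underS \<delta>"
          using less_trans[OF \<nu> \<beta>_less] .
        have "consistent X \<sigma> W c \<nu>"
          using less.IH[OF less_trans[OF \<nu> \<beta>] underS_under[OF \<nu>_less]] .
        then have "response \<Sigma> \<nu> p (nonempty_strategy \<Sigma> \<nu> (restrict p (underS \<nu>)))"
          using nonempty_strategy_response[where p = p and \<Sigma> = \<Sigma> and \<alpha> = \<nu>] \<sigma> 2(1)
            below_\<gamma>[OF \<nu>_less] bm_play_mono[OF play \<nu>_less]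
          by (simp add: defs)
        then have "response \<Sigma> \<nu> p (p \<nu>)"
          using follows 2(1) \<nu>_less by (simp add: bm_follows_def)
        then have "\<exists>V. maximal_antichain_below Q r X V \<and> answer \<sigma> W c \<beta> V = p \<beta>"
          using legal[OF \<beta>_less] \<nu> 2(2) by (simp add: response_def all_below_answers_def defs)
        moreover have empty: "empty_moves_at \<kappa> \<beta>"
          using 2 empty_moves_at_nonempty_moves_at.suc_nonempty by simp
        moreover have "\<beta> \<noteq> first"
          using \<nu> underS_first by auto
        ultimately show ?thesis
          using cut_moves_empty[of \<beta> X \<sigma> p] by (simp add: W_def c_def choices_def)
      qed
    qed
    then show ?case
      by (simp add: consistent_def)
  qed
  then have "consistent X \<sigma> W c \<delta>"
    using \<delta>_Field under_eq by simp
  then show ?thesis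
    by (simp add: defs)
qed

theorem choose_wins_imp_nonempty_wins:
  assumes \<Sigma>: "\<And>X. X \<in> Q \<Longrightarrow> choose_winning X (\<Sigma> X)"
  shows "nonempty_winning (nonempty_strategy \<Sigma>)"
  unfolding bm_nonempty_winning_def
proof (intro conjI ballI allI impI)
  fix \<delta> p
  assume \<delta>: "\<delta> \<in> underS \<gamma>"
    and *: "nonempty_moves_at \<kappa> \<delta> \<and> bm_play \<kappa> Q (\<lambda>x y. (x, y) \<in> r) \<delta> p \<and>
      bm_follows \<kappa> (nonempty_strategy \<Sigma>) \<delta> p"
  then have "p first \<in> Q"
    using nonempty_move_not_first[of \<delta>] by (auto simp: bm_play_def bm_legal_move_def)
  then have "response \<Sigma> \<delta> p (nonempty_strategy \<Sigma> \<delta> (restrict p (underS \<delta>)))"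
    using nonempty_strategy_response[where p = p and \<Sigma> = \<Sigma> and \<alpha> = \<delta>] \<delta> * \<Sigma>
      play_consistent[where p = p and \<Sigma> = \<Sigma> and \<delta> = \<delta>, OF \<Sigma> underS_under[OF \<delta>]] by simp
  then show "bm_legal_move \<kappa> Q (\<lambda>x y. (x, y) \<in> r) \<delta> p
      (nonempty_strategy \<Sigma> \<delta> (restrict p (underS \<delta>)))"
    by (simp add: response_def bm_legal_move_def)
next
  fix p
  assume *: "bm_play \<kappa> Q (\<lambda>x y. (x, y) \<in> r) \<gamma> p \<and> bm_follows \<kappa> (nonempty_strategy \<Sigma>) \<gamma> p"
  define X \<sigma> W c where "X = p first" and "\<sigma> = \<Sigma> X" and "W = cut_moves X \<sigma> p" and "c = choices X p"
  note defs = X_def \<sigma>_def W_def c_def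
  have legal: "p t \<in> Q \<and> (\<forall>u\<in>underS t. (p t, p u) \<in> r)" if "t \<in> underS \<gamma>" for t
    using * that by (auto simp: bm_play_def bm_legal_move_def)
  have \<sigma>: "choose_winning X \<sigma>"
    using \<Sigma> legal[OF first_less_length] by (simp add: defs)
  have "\<gamma> \<in> under \<gamma>"
    using under_eq[OF limit_Field[OF limit_length]] by simp
  then have "consistent X \<sigma> W c \<gamma>"
    using play_consistent[where p = p and \<Sigma> = \<Sigma> and \<delta> = \<gamma>, OF \<Sigma>] * by (simp add: defs)
  then have "L (c ` underS \<gamma>)"
    using \<sigma> by (auto simp: cc_choose_winning_def consistent_def answer_actual choose_won_def)
  then show "L (p ` underS \<gamma>)"
  proof (rule win_mono)
    fix b assume "b \<in> p ` underS \<gamma>"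
    then obtain t where t: "t \<in> underS \<gamma>" "b = p t"
      by blast
    have t_Field: "t \<in> Field \<kappa>"
      using less_Field[OF t(1)] by simp
    show "\<exists>a\<in>c ` underS \<gamma>. (a, b) \<in> r"
    proof (cases "empty_moves_at \<kappa> t")
      case True
      then have "c t = b"
        using t by (simp add: c_def choices_def)
      moreover have "(b, b) \<in> r"
        using t legal[OF t(1)] refl by simp
      ultimately show ?thesis
        using t(1) by auto
    next
      case False
      then have "empty_moves_at \<kappa> (succ t)"
        using moves_total[OF t_Field] empty_moves_at_nonempty_moves_at.suc_nonempty by simp
      then have "c (succ t) = p (succ t)"
        by (simp add: c_def choices_def)
      moreover have succ_t: "succ t \<in> underS \<gamma>"
        using succ_less_limit[OF limit_length t(1)] .
      moreover have "(p (succ t), b) \<in> r"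
        using legal[OF succ_t] less_succ[OF t_Field] t(2) by simp
      ultimately show ?thesis
        using imageI[OF succ_t, of c] by (intro bexI[of _ "c (succ t)"]) simp_all
    qed
  qed
qed

theorem nonempty_wins_iff_choose_wins:
  "(\<exists>\<tau>. nonempty_winning \<tau>) \<longleftrightarrow> (\<forall>X\<in>Q. \<exists>\<sigma>. choose_winning X \<sigma>)"
proof
  assume "\<exists>\<tau>. nonempty_winning \<tau>"
  then show "\<forall>X\<in>Q. \<exists>\<sigma>. choose_winning X \<sigma>"
    using nonempty_wins_imp_choose_wins by blast
next
  assume "\<forall>X\<in>Q. \<exists>\<sigma>. choose_winning X \<sigma>"
  then obtain \<Sigma> where "\<And>X. X \<in> Q \<Longrightarrow> choose_winning X (\<Sigma> X)"
    by metis
  then show "\<exists>\<tau>. nonempty_winning \<tau>"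
    using choose_wins_imp_nonempty_wins by blast
qed

end

section \<open>Ideals and posets\<close>

lemma unbounded_well_order_regular_uncountable:
  assumes "regular_uncountable \<kappa>"
  shows "unbounded_well_order \<kappa>"
proof
  have card: "Card_order \<kappa>" and inf: "natLeq <o \<kappa>"
    using assms by (auto simp: regular_uncountable_def)
  show "Well_order \<kappa>"
    using card by (auto simp: card_order_on_def)
  have "\<not> finite (Field \<kappa>)"
    using infinite_iff_natLeq_ordLeq ordLeq_transitive[OF ordLess_imp_ordLeq[OF inf]]
      card_of_Field_ordIso[OF card] ordIso_symmetric ordIso_iff_ordLeq by metis
  then show "\<exists>\<beta>. \<alpha> \<in> Order_Relation.underS \<kappa> \<beta>" if "\<alpha> \<in> Field \<kappa>" for \<alpha>
    using infinite_Card_order_limit[OF card _ that] by (auto simp: Order_Relation.underS_def)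
qed

lemma compatible_positive_sets:
  assumes I: "ideal_on S I" and A: "A \<in> positive_sets S I"
  shows "compatible (positive_sets S I) {(A, B). A \<subseteq> B} A B \<longleftrightarrow> A \<inter> B \<notin> I"
proof
  assume "A \<inter> B \<notin> I"
  then have "A \<inter> B \<in> positive_sets S I"
    using A by (auto simp: positive_sets_def)
  then show "compatible (positive_sets S I) {(A, B). A \<subseteq> B} A B"
    unfolding compatible_def by (rule rev_bexI) simp
next
  assume "compatible (positive_sets S I) {(A, B). A \<subseteq> B} A B"
  then obtain C where C: "C \<notin> I" "C \<subseteq> A \<inter> B"
    by (auto simp: compatible_def positive_sets_def)
  have "\<And>A B. A \<in> I \<Longrightarrow> B \<subseteq> A \<Longrightarrow> B \<in> I"
    using I unfolding ideal_on_def by blast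
  then show "A \<inter> B \<notin> I"
    using C by metis
qed

lemma ideal_partition_iff_maximal_antichain:
  assumes I: "ideal_on S I"
  shows "ideal_partition S I X W \<longleftrightarrow>
    maximal_antichain_below (positive_sets S I) {(A, B). A \<subseteq> B} X W"
proof -
  let ?P = "positive_sets S I" and ?R = "{(A, B). A \<subseteq> B}"
  have "almost_disjoint_family S I X V \<longleftrightarrow> antichain_below ?P ?R X V" for V
  proof -
    have "(A \<noteq> B \<longrightarrow> A \<inter> B \<in> I) \<longleftrightarrow> (A \<noteq> B \<longrightarrow> \<not> compatible ?P ?R A B)"
      if "V \<subseteq> ?P" "A \<in> V" for A B
      using compatible_positive_sets[OF I subsetD[OF that]] by simp
    then have "(\<forall>A\<in>V. \<forall>B\<in>V. A \<noteq> B \<longrightarrow> A \<inter> B \<in> I) \<longleftrightarrow>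
        (\<forall>A\<in>V. \<forall>B\<in>V. A \<noteq> B \<longrightarrow> \<not> compatible ?P ?R A B)" if "V \<subseteq> ?P"
      using that by (intro ball_cong HOL.refl)
    moreover have "V \<subseteq> Pow X \<inter> ?P \<longleftrightarrow> V \<subseteq> {q \<in> ?P. (q, X) \<in> ?R}"
      by auto
    moreover have "V \<subseteq> ?P" if "V \<subseteq> {q \<in> ?P. (q, X) \<in> ?R}"
      using that by auto
    ultimately show ?thesis
      unfolding almost_disjoint_family_def antichain_below_def by (intro conj_cong) simp_all
  qed
  then show ?thesis
    by (simp add: ideal_partition_def maximal_antichain_below_def)
qed

text \<open>
  Winning conditions only matter on sequences of legal picks. This is used for the ideal game, where
  an intersection containing a positive set is itself positive only if it is a subset of \<open>\<kappa>\<close>.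
\<close>

lemma cc_choose_winning_cong:
  assumes "\<And>c W. \<lbrakk>\<And>\<alpha>. \<alpha> \<in> underS \<kappa> \<gamma> \<Longrightarrow> legal (W \<alpha>); \<And>\<alpha>. \<alpha> \<in> underS \<kappa> \<gamma> \<Longrightarrow> c \<alpha> \<in> W \<alpha>\<rbrakk>
    \<Longrightarrow> won c \<longleftrightarrow> won' c"
  shows "cc_choose_winning \<kappa> legal \<gamma> won \<sigma> \<longleftrightarrow> cc_choose_winning \<kappa> legal \<gamma> won' \<sigma>"
  unfolding cc_choose_winning_def
  by (intro iff_allI imp_cong[OF HOL.refl] conj_cong[OF HOL.refl] assms) auto

theorem theorem7p4:
  fixes \<kappa> :: "'k rel" and I :: "'k set set" and \<gamma> :: 'k and Q :: "'q set" and r :: "'q rel"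
  assumes "regular_uncountable \<kappa>"
    and "ideal_on (Field \<kappa>) I"
    and "\<gamma> \<in> Field \<kappa>" and "limit_ordinal \<kappa> \<gamma>"
    and "poset_with_maximal Q r"
  shows "(nonempty_wins_B_ideal \<kappa> I \<gamma> \<longleftrightarrow>
            (\<forall>X\<in>positive_sets (Field \<kappa>) I. choose_wins_G_ideal \<kappa> X I \<gamma>)) \<and>
         (nonempty_wins_B_poset \<kappa> Q r \<gamma> \<longleftrightarrow>
            (\<forall>X\<in>Q. choose_wins_G_poset \<kappa> X Q r \<gamma>))"
proof
  interpret unbounded_well_order \<kappa>
    using assms(1) by (rule unbounded_well_order_regular_uncountable)
  show "nonempty_wins_B_ideal \<kappa> I \<gamma> \<longleftrightarrow>
      (\<forall>X\<in>positive_sets (Field \<kappa>) I. choose_wins_G_ideal \<kappa> X I \<gamma>)"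
  proof -
    let ?P = "positive_sets (Field \<kappa>) I" and ?R = "{(A, B). A \<subseteq> B} :: 'k set rel"
    interpret G: game_setting \<kappa> \<gamma> ?P ?R "\<lambda>S. \<Inter>S \<noteq> {}"
    proof
      show "limit_ordinal \<kappa> \<gamma>" by (rule assms(4))
      show "trans ?R" by (auto simp: trans_def)
      show "\<Inter>B \<noteq> {}" if "\<Inter>A \<noteq> {}" "\<And>b. b \<in> B \<Longrightarrow> \<exists>a\<in>A. (a, b) \<in> ?R"
        for A B :: "'k set set"
      proof -
        have "\<Inter>A \<subseteq> \<Inter>B"
          using that(2) by (auto simp: subset_iff)
        then show ?thesis
          using that(1) by auto
      qed
    qed simp
    have won_iff: "G.choose_won c \<longleftrightarrow>
        (\<forall>\<delta>\<in>underS \<gamma>. (\<Inter>\<alpha>\<in>under \<delta>. c \<alpha>) \<in> ?P) \<and> (\<Inter>\<alpha>\<in>underS \<gamma>. c \<alpha>) \<noteq> {}"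
      if c: "\<And>\<alpha>. \<alpha> \<in> underS \<gamma> \<Longrightarrow> c \<alpha> \<in> ?P" for c
    proof -
      have "(\<exists>q\<in>?P. \<forall>\<alpha>\<in>under \<delta>. (q, c \<alpha>) \<in> ?R) \<longleftrightarrow> (\<Inter>\<alpha>\<in>under \<delta>. c \<alpha>) \<in> ?P"
        if \<delta>: "\<delta> \<in> underS \<gamma>" for \<delta>
      proof
        assume "\<exists>q\<in>?P. \<forall>\<alpha>\<in>under \<delta>. (q, c \<alpha>) \<in> ?R"
        then obtain q where q: "q \<in> ?P" "q \<subseteq> (\<Inter>\<alpha>\<in>under \<delta>. c \<alpha>)"
          by (auto simp: subset_iff)
        have "(\<Inter>\<alpha>\<in>under \<delta>. c \<alpha>) \<subseteq> c \<delta>"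
          using under_eq[of \<delta>] less_Field[OF \<delta>] by auto
        then have "(\<Inter>\<alpha>\<in>under \<delta>. c \<alpha>) \<subseteq> Field \<kappa>"
          using c[OF \<delta>] by (auto simp: positive_sets_def)
        moreover have "(\<Inter>\<alpha>\<in>under \<delta>. c \<alpha>) \<notin> I"
          using q assms(2) unfolding positive_sets_def ideal_on_def by blast
        ultimately show "(\<Inter>\<alpha>\<in>under \<delta>. c \<alpha>) \<in> ?P"
          by (simp add: positive_sets_def)
      next
        assume "(\<Inter>\<alpha>\<in>under \<delta>. c \<alpha>) \<in> ?P"
        then show "\<exists>q\<in>?P. \<forall>\<alpha>\<in>under \<delta>. (q, c \<alpha>) \<in> ?R"
          by (rule rev_bexI) auto
      qed
      then show ?thesis
        by (simp add: G.choose_won_def)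
    qed
    have legal: "ideal_partition (Field \<kappa>) I X = maximal_antichain_below ?P ?R X" for X
      using ideal_partition_iff_maximal_antichain[OF assms(2)] by (rule ext)
    have "choose_wins_G_ideal \<kappa> X I \<gamma> \<longleftrightarrow> (\<exists>\<sigma>. G.choose_winning X \<sigma>)" for X
    proof -
      have "c \<alpha> \<in> ?P"
        if "\<alpha> \<in> underS \<gamma>" "\<And>\<alpha>. \<alpha> \<in> underS \<gamma> \<Longrightarrow> maximal_antichain_below ?P ?R X (W \<alpha>)"
          "\<And>\<alpha>. \<alpha> \<in> underS \<gamma> \<Longrightarrow> c \<alpha> \<in> W \<alpha>" for c \<alpha> and W :: "'k \<Rightarrow> 'k set set"
        using that(2)[OF that(1)] that(3)[OF that(1)]
        by (auto simp: maximal_antichain_below_def antichain_below_def)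
      then have "G.choose_winning X \<sigma> \<longleftrightarrow>
          cc_choose_winning \<kappa> (maximal_antichain_below ?P ?R X) \<gamma>
            (\<lambda>c. (\<forall>\<delta>\<in>underS \<gamma>. (\<Inter>\<alpha>\<in>under \<delta>. c \<alpha>) \<in> ?P) \<and> (\<Inter>\<alpha>\<in>underS \<gamma>. c \<alpha>) \<noteq> {}) \<sigma>" for \<sigma>
        by (intro cc_choose_winning_cong won_iff) blast
      then show ?thesis
        by (simp add: choose_wins_G_ideal_def legal)
    qed
    then show ?thesis
      using G.nonempty_wins_iff_choose_wins by (simp add: nonempty_wins_B_ideal_def)
  qed
  show "nonempty_wins_B_poset \<kappa> Q r \<gamma> \<longleftrightarrow> (\<forall>X\<in>Q. choose_wins_G_poset \<kappa> X Q r \<gamma>)"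
  proof -
    have trans: "trans r" and refl: "\<And>q. q \<in> Q \<Longrightarrow> (q, q) \<in> r"
      using assms(5)
      by (auto simp: poset_with_maximal_def partial_order_on_def preorder_on_def refl_on_def)
    interpret G: game_setting \<kappa> \<gamma> Q r "\<lambda>S. \<exists>q\<in>Q. \<forall>a\<in>S. (q, a) \<in> r"
    proof
      show "limit_ordinal \<kappa> \<gamma>" by (rule assms(4))
      show "(q, q) \<in> r" if "q \<in> Q" for q by (rule refl[OF that])
      show "trans r" by (rule trans)
      show "\<exists>q\<in>Q. \<forall>b\<in>B. (q, b) \<in> r"
        if "\<exists>q\<in>Q. \<forall>a\<in>A. (q, a) \<in> r" "\<And>b. b \<in> B \<Longrightarrow> \<exists>a\<in>A. (a, b) \<in> r" for A B
        using that transD[OF trans] by meson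
    qed
    have "G.choose_won c \<longleftrightarrow> (\<exists>q\<in>Q. \<forall>\<alpha>\<in>underS \<gamma>. (q, c \<alpha>) \<in> r)" for c
    proof -
      have "\<exists>q\<in>Q. \<forall>\<alpha>\<in>under \<delta>. (q, c \<alpha>) \<in> r"
        if "\<exists>q\<in>Q. \<forall>\<alpha>\<in>underS \<gamma>. (q, c \<alpha>) \<in> r" "\<delta> \<in> underS \<gamma>" for \<delta>
        using that(1) under_subset_underS[OF that(2)] by (meson subsetD)
      then show ?thesis
        unfolding G.choose_won_def by auto
    qed
    then have "G.choose_won = (\<lambda>c. \<exists>q\<in>Q. \<forall>\<alpha>\<in>underS \<gamma>. (q, c \<alpha>) \<in> r)"
      by (rule ext)
    then show ?thesis
      using G.nonempty_wins_iff_choose_wins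
      by (simp add: nonempty_wins_B_poset_def choose_wins_G_poset_def)
  qed
qed

end
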